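(* For all integers $m,n$, $$ q^{-\frac{(\nu+m)n}{2}+m\nu+\binom m2}\, J^{(2)}_{\nu+m}\big(xq^{\frac n2};q\big) = R^{(2)}_{m,n,\nu}(x;q)\, J^{(2)}_\nu(x;q) - R^{(2)}_{m-1,n,\nu+1}(x;q)\, J^{(2)}_{\nu-1}(x;q), $$ where $$ R^{(2)}_{m,n,\nu}(x;q) := \frac{(q^{\nu+m+1};q)_\infty}{(q^{\nu-1};q)_\infty\,(-x^2/4;q)_{\max\{n,0\}}}\,(-1)^{\max\{m+1,0\}}\, q^{\min\{m+1,0\}\nu+\binom m2-1}\left(\frac x2\right)^{\min\{m+2,\,-m\}} P^{(2)}_{m+1,n,\nu}(x;q), $$ and $P^{(2)}_{m,n,\nu}(x;q)$ is the explicit polynomial defined in the context, which is a polynomial in $x^2$ of degree at most $\left\lfloor\frac{m+n+1}{2}\right\rfloor-\min\{m,n,m+n,0\}-1$.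
   Context: Here $0<q<1$. The $q$-shifted factorials are $(a;q)_0=1$, $(a;q)_j=(1-a)(1-aq)\cdots(1-aq^{j-1})$ for $j\ge 1$, $(a;q)_{-j}=1/(aq^{-j};q)_j=\frac{1}{(1-aq^{-1})\cdots(1-aq^{-j})}$ for $j\ge1$, and $(a;q)_\infty=\prod_{j\ge0}(1-aq^j)$. In particular $1/(q;q)_j=(q^{j+1};q)_{-j}=0$ for $j<0$. For every integer $j$, $\binom j2:=j(j-1)/2$. The basic hypergeometric series is $$ {}_r\phi_s(a_1,\dots,a_r;b_1,\dots,b_s;q,x)=\sum_{j=0}^\infty \frac{(a_1;q)_j\cdots(a_r;q)_j}{(q;q)_j(b_1;q)_j\cdots(b_s;q)_j}\Big\{(-1)^jq^{\binom j2}\Big\}^{1+s-r}x^j, $$ where no lower parameter $b_i$ equals $1$ or a negative integer power of $q$; a dash denotes an empty list of upper parameters. Throughout, parameters take values in the region where the series converge and the rational functions involved are defined. $\lfloor y\rfloor$ is the greatest integer not exceeding $y$. Jackson's second $q$-Bessel function is $$ J^{(2)}_\nu(x;q):=\frac{(q^{\nu+1};q)_\infty}{(q;q)_\infty}\left(\frac x2\right)^\nu {}_0\phi_1\Big(-;\,q^{\nu+1};\,q,\,-\frac{x^2q^{\nu+1}}{4}\Big),\qquad x\in\mathbb C. $$ Definition of $P^{(2)}$: put $g:=\left\lfloor\frac{m+n+1}2\right\rfloor-\min\{m,n,m+n,0\}-1$ and $$ P^{(2)}_{m,n,\nu}(x;q):=\begin{cases}\sum_{j=0}^{g}\left(\frac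 x2\right)^{2j}(-1)^jq^{j\nu}\Big(A_{m,n,\nu,\,j+\min\{m,0\}}-B_{m,n,\nu,\,j-\max\{m,0\}}\Big), & n\ge0,\\[2pt] \sum_{j=0}^{g}\left(\frac x2\right)^{2j}(-1)^jq^{j\nu}\Big(\tilde A_{m,n,\nu,\,j+\min\{m,0\}}-\tilde B_{m,n,\nu,\,j-\max\{m,0\}}\Big), & n<0,\end{cases} $$ (empty sums are $0$), where $$ A_{m,n,\nu,j}:=\frac{(q^\nu;q)_m}{(q;q)_j(q^{2-\nu};q)_{j-m}}\,q^{(j-m+1)n-(j-m+n)\nu}\;{}_2\phi_1\big(q^{-j},\,q^{\nu+m-j-1};\;q^\nu;\;q,\,q^{2j-m-n+1}\big), $$ $$ B_{m,n,\nu,j}:=\frac{1}{(q;q)_j(q^{2-\nu};q)_j}\,q^{j(j+1)-2j\nu}\;{}_2\phi_1\big(q^{-j},\,q^{\nu-j-1};\;q^{\nu+m};\;q,\,q^{n+1}\big), $$ $$ \tilde A_{m,n,\nu,j}:=\frac{(q^\nu;q)_m}{(q;q)_j(q^{2-\nu};q)_{j-m}}\,q^{(j-m+1)(j+n)-(2j-m+n)\nu}\;{}_2\phi_1\big(q^{-j},\,q^{\nu+m-j-1};\;q^\nu;\;q,\,q^{1-n}\big), $$ $$ \tilde B_{m,n,\nu,j}:=\frac{1}{(q;q)_j(q^{2-\nu};q)_j}\,q^{-j\nu}\;{}_2\phi_1\big(q^{-j},\,q^{\nu-j-1};\;q^{\nu+m};\;q,\,q^{2j+m+n+1}\big). $$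 For $j<0$ one has $A_{m,n,\nu,j}=B_{m,n,\nu,j}=\tilde A_{m,n,\nu,j}=\tilde B_{m,n,\nu,j}=0$ (because of the factor $1/(q;q)_j$). *)

theory Defs
  imports "HOL-Analysis.Analysis" "HOL-Computational_Algebra.Polynomial"
begin

definition qpow :: "real \<Rightarrow> complex \<Rightarrow> complex" where
  "qpow q s = of_real q powr s"

text \<open>
  The shifted factorial with an integer index.  The value for a negative index may involve a
  division by zero; since \<open>1 / 0 = 0\<close>, this gives \<open>1 / qpoch q q j = 0\<close> for \<open>j < 0\<close>,
  which is exactly the usual convention.
\<close>

definition qpoch :: "complex \<Rightarrow> real \<Rightarrow> int \<Rightarrow> complex" where
  "qpoch a q k =
     (if 0 \<le> k then \<Prod>i<nat k. 1 - a * of_real q ^ i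
      else 1 / (\<Prod>i<nat (- k). 1 - (a * of_real q powi k) * of_real q ^ i))"

definition qpoch_inf :: "complex \<Rightarrow> real \<Rightarrow> complex" where
  "qpoch_inf a q = (\<Prod>i. 1 - a * of_real q ^ i)"

definition basic_hypergeom :: "complex list \<Rightarrow> complex list \<Rightarrow> real \<Rightarrow> complex \<Rightarrow> complex" where
  "basic_hypergeom as bs q x =
     (\<Sum>j. (\<Prod>a\<leftarrow>as. qpoch a q (int j)) /
           (qpoch (of_real q) q (int j) * (\<Prod>b\<leftarrow>bs. qpoch b q (int j))) *
           ((-1) ^ j * of_real q ^ (j choose 2)) powi (1 + int (length bs) - int (length as)) *
           x ^ j)"

text \<open>
  The principal branch of \<open>z\<^sup>s\<close>, with \<open>0\<^sup>0 = 1\<close> (the operation \<open>powr\<close> has \<open>0 powr 0 = 0\<close>).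
\<close>

definition cpow :: "complex \<Rightarrow> complex \<Rightarrow> complex" where
  "cpow z s = (if z = 0 \<and> s = 0 then 1 else z powr s)"

definition jackson_bessel2 :: "complex \<Rightarrow> complex \<Rightarrow> real \<Rightarrow> complex" where
  "jackson_bessel2 \<nu> x q =
     qpoch_inf (qpow q (\<nu> + 1)) q / qpoch_inf (of_real q) q * cpow (x / 2) \<nu> *
     basic_hypergeom [] [qpow q (\<nu> + 1)] q (- (x\<^sup>2 * qpow q (\<nu> + 1) / 4))"

definition A2 :: "int \<Rightarrow> int \<Rightarrow> complex \<Rightarrow> int \<Rightarrow> real \<Rightarrow> complex" where
  "A2 m n \<nu> j q =
     qpoch (qpow q \<nu>) q m / (qpoch (of_real q) q j * qpoch (qpow q (2 - \<nu>)) q (j - m)) *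
     qpow q (of_int ((j - m + 1) * n) - of_int (j - m + n) * \<nu>) *
     basic_hypergeom [qpow q (of_int (- j)), qpow q (\<nu> + of_int (m - j - 1))] [qpow q \<nu>]
       q (qpow q (of_int (2 * j - m - n + 1)))"

definition B2 :: "int \<Rightarrow> int \<Rightarrow> complex \<Rightarrow> int \<Rightarrow> real \<Rightarrow> complex" where
  "B2 m n \<nu> j q =
     1 / (qpoch (of_real q) q j * qpoch (qpow q (2 - \<nu>)) q j) *
     qpow q (of_int (j * (j + 1)) - of_int (2 * j) * \<nu>) *
     basic_hypergeom [qpow q (of_int (- j)), qpow q (\<nu> - of_int (j + 1))] [qpow q (\<nu> + of_int m)]
       q (qpow q (of_int (n + 1)))"

definition A2' :: "int \<Rightarrow> int \<Rightarrow> complex \<Rightarrow> int \<Rightarrow> real \<Rightarrow> complex" where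
  "A2' m n \<nu> j q =
     qpoch (qpow q \<nu>) q m / (qpoch (of_real q) q j * qpoch (qpow q (2 - \<nu>)) q (j - m)) *
     qpow q (of_int ((j - m + 1) * (j + n)) - of_int (2 * j - m + n) * \<nu>) *
     basic_hypergeom [qpow q (of_int (- j)), qpow q (\<nu> + of_int (m - j - 1))] [qpow q \<nu>]
       q (qpow q (of_int (1 - n)))"

definition B2' :: "int \<Rightarrow> int \<Rightarrow> complex \<Rightarrow> int \<Rightarrow> real \<Rightarrow> complex" where
  "B2' m n \<nu> j q =
     1 / (qpoch (of_real q) q j * qpoch (qpow q (2 - \<nu>)) q j) *
     qpow q (- of_int j * \<nu>) *
     basic_hypergeom [qpow q (of_int (- j)), qpow q (\<nu> - of_int (j + 1))] [qpow q (\<nu> + of_int m)]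
       q (qpow q (of_int (2 * j + m + n + 1)))"

definition P2_bound :: "int \<Rightarrow> int \<Rightarrow> int" where
  "P2_bound m n = \<lfloor>real_of_int (m + n + 1) / 2\<rfloor> - Min {m, n, m + n, 0} - 1"

definition P2 :: "int \<Rightarrow> int \<Rightarrow> complex \<Rightarrow> complex \<Rightarrow> real \<Rightarrow> complex" where
  "P2 m n \<nu> x q =
     (if 0 \<le> n then
        \<Sum>j = 0..P2_bound m n. (x / 2) powi (2 * j) * (-1) powi j * qpow q (of_int j * \<nu>) *
          (A2 m n \<nu> (j + min m 0) q - B2 m n \<nu> (j - max m 0) q)
      else
        \<Sum>j = 0..P2_bound m n. (x / 2) powi (2 * j) * (-1) powi j * qpow q (of_int j * \<nu>) *
          (A2' m n \<nu> (j + min m 0) q - B2' m n \<nu> (j - max m 0) q))"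

text \<open>
  No denominator in \<^term>\<open>P2 m n \<nu> x q\<close> vanishes: the lower parameters \<open>q\<^sup>\<nu>\<close> and \<open>q\<^sup>\<nu>\<^sup>+\<^sup>m\<close> of the
  series are not \<open>1\<close> or a negative integer power of \<open>q\<close>, and \<open>(q\<^sup>2\<^sup>-\<^sup>\<nu>; q)\<^sub>i\<close> is nonzero for
  \<open>i = j - max m 0\<close>.  The latter is the index in both parts of the summand, because
  \<open>(j + min m 0) - m = j - max m 0\<close>.  The condition on \<open>q\<^sup>\<nu>\<^sup>+\<^sup>m\<close> also makes \<open>(q\<^sup>\<nu>; q)\<^sub>m\<close> well defined
  for negative \<open>m\<close>.
\<close>

definition P2_defined :: "int \<Rightarrow> int \<Rightarrow> complex \<Rightarrow> real \<Rightarrow> bool" where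
  "P2_defined m n \<nu> q \<longleftrightarrow>
     (\<forall>k::nat. qpow q (\<nu> + of_nat k) \<noteq> 1) \<and>
     (\<forall>k::nat. qpow q (\<nu> + of_int m + of_nat k) \<noteq> 1) \<and>
     (\<forall>j\<in>{0..P2_bound m n}. qpoch (qpow q (2 - \<nu>)) q (j - max m 0) \<noteq> 0)"

definition R2 :: "int \<Rightarrow> int \<Rightarrow> complex \<Rightarrow> complex \<Rightarrow> real \<Rightarrow> complex" where
  "R2 m n \<nu> x q =
     qpoch_inf (qpow q (\<nu> + of_int m + 1)) q /
       (qpoch_inf (qpow q (\<nu> - 1)) q * qpoch (- (x\<^sup>2 / 4)) q (max n 0)) *
     (-1) powi max (m + 1) 0 *
     qpow q (of_int (min (m + 1) 0) * \<nu> + of_int (m * (m - 1)) / 2 - 1) *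
     (x / 2) powi min (m + 2) (- m) *
     P2 (m + 1) n \<nu> x q"

end

theory Submission
  imports Defs "HOL-Computational_Algebra.Computational_Algebra"
begin

text \<open>
  Put \<open>z = x\<^sup>2 / 4\<close> and \<open>a = q\<^sup>\<nu>\<close>.  Up to elementary factors, the functions
  \<open>J\<^sub>\<nu>\<^sub>+\<^sub>m(x q\<^sup>n\<^sup>/\<^sup>2)\<close> form a family \<open>h(m, n)\<close> with two first-order relations
  \<open>(1 + z q\<^sup>n) h(m, n+1) = h(m, n) + q\<^sup>n h(m+1, n)\<close> and
  \<open>h(m, n) = a q\<^sup>m h(m, n+1) + z h(m-1, n+1)\<close>.  Walking from \<open>(0, 0)\<close> and \<open>(-1, 0)\<close> to
  \<open>(m, n)\<close> along these relations writes \<open>h(m, n)\<close> as a combination of \<open>h(0, 0)\<close> and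
  \<open>h(-1, 0)\<close> whose coefficients are polynomials \<open>S\<close>, \<open>T\<close> in \<open>z\<close>, up to powers of \<open>z\<close>
  and, for \<open>n \<ge> 0\<close>, the denominator \<open>(-z; q)\<^sub>n\<close>.  The polynomials depend on the relations alone, not on the
  solution, and the walk bounds their degrees by the upper limit of summation in
  \<open>P\<^sup>(\<^sup>2\<^sup>)\<close> (lemma \<open>reducible_all\<close>).

  It remains to find \<open>S\<close> and \<open>T\<close> explicitly.  The functions \<open>J\<^sub>-\<^sub>\<nu>\<^sub>-\<^sub>m\<close>, suitably
  normalised, satisfy the same relations, so Cramer's rule expresses \<open>S\<close> and \<open>T\<close> by
  two-by-two determinants of Bessel functions (\<open>reduction_casorati\<close>).  The determinant in the
  denominator, times \<open>z\<close>, satisfies \<open>(1 + z) w(q z) = w(z)\<close> and is therefore a constant times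
  \<open>(-z; q)\<^sub>\<infinity>\<close> (\<open>wronski_eq\<close>).  That product is also the quotient of Jackson's second and
  first \<open>q\<close>-Bessel functions (\<open>bessel2_eq_euler_bessel1\<close>); hence \<open>S\<close> and \<open>T\<close> are sums of
  two products, each of a first and a second Bessel series.  The coefficients of such a product are
  terminating \<open>\<^sub>2\<phi>\<^sub>1\<close> series, which can be summed from either end
  (\<open>mixed_prod_coeff_by_second\<close>, \<open>mixed_prod_coeff_by_first\<close>), and these are the quantities
  \<open>A\<close> and \<open>B\<close>.  Which factor carries the first Bessel series depends on the sign of
  \<open>n\<close>, whence the two cases of \<open>P\<^sup>(\<^sup>2\<^sup>)\<close>.  The infinite sums produced by Cramer's rule stop
  at the degree bound because \<open>S\<close> and \<open>T\<close> are polynomials.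

  Cramer's rule needs the two solutions to be independent, that is, \<open>q\<^sup>\<nu>\<close> not to be an
  integral power of \<open>q\<close>.  The coefficients of \<open>S\<close> and \<open>T\<close> are continuous in \<open>a \<noteq> 0\<close>,
  and so are the explicit ones wherever their denominators do not vanish, so the remaining orders follow
  by letting \<open>\<nu> + t\<close> tend to \<open>\<nu>\<close> (\<open>generic_limit\<close>).  Convergence matters only in the
  last step, when the identity of formal power series is evaluated at \<open>z\<close>.
\<close>

unbundle no vec_syntax

section \<open>Shifted factorials and their infinite products\<close>

locale q_base =
  fixes q :: real
  assumes q_pos: "0 < q" and q_less_1: "q < 1"
begin

abbreviation Q :: complex where "Q \<equiv> of_real q"

lemma q_nz [simp]: "q \<noteq> 0" using q_pos by simp

lemma Q_nz: "Q \<noteq> 0"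
  by simp

lemma norm_Q_powi: "norm (Q powi k) = q powi k"
  using q_pos by (simp add: norm_power_int)

lemma Q_powi_eq_1_iff: "Q powi k = 1 \<longleftrightarrow> k = 0"
proof
  assume "Q powi k = 1"
  hence "q powi k = 1" using norm_Q_powi[of k] by simp
  hence "q powr real_of_int k = 1" using q_pos by (simp add: powr_real_of_int')
  thus "k = 0" using q_pos q_less_1 powr_eq_one_iff_gen[of q "real_of_int k"] by simp
qed simp

lemma Q_power_Suc_neq_1: "Q ^ Suc l \<noteq> 1"
  using Q_powi_eq_1_iff[of "int (Suc l)"] unfolding power_int_of_nat by simp

definition qinf :: "complex \<Rightarrow> complex" where "qinf a = qpoch_inf a q"

lemma qinf_convergent: "convergent_prod (\<lambda>i. 1 - a * Q ^ i)"
proof (rule abs_convergent_prod_imp_convergent_prod)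
  have "summable (\<lambda>i. norm a * q ^ i)"
    using q_pos q_less_1 by (intro summable_mult summable_geometric) auto
  thus "abs_convergent_prod (\<lambda>i. 1 - a * Q ^ i)"
    unfolding abs_convergent_prod_conv_summable using q_pos
    by (simp add: norm_mult norm_power)
qed

text \<open>
  Infinite products are used in place of finite shifted factorials wherever possible: they obey this
  single relation without any exception, even where factors vanish.
\<close>

lemma qinf_step: "qinf a = (1 - a) * qinf (a * Q)"
proof (cases "a = 1")
  case True
  \<comment> \<open>the only vanishing factor is the first one, since the tail is \<open>(q; q)\<^sub>\<infinity>\<close>\<close>
  have "(\<lambda>i. 1 - a * Q ^ i) has_prod 0"
  proof -
    have "convergent_prod (\<lambda>i. 1 - a * Q ^ (i + 1))"
      using qinf_convergent[of "a * Q"] by (simp add: mult.assoc)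
    moreover have "1 - a * Q ^ (i + 1) \<noteq> 0" for i
      using Q_power_Suc_neq_1[of i] True by simp
    ultimately have "\<exists>p. raw_has_prod (\<lambda>i. 1 - a * Q ^ (i + 1)) 0 p"
      by (meson convergent_prod_offset_0)
    then obtain p where "raw_has_prod (\<lambda>i. 1 - a * Q ^ i) (Suc 0) p"
      by (auto simp: raw_has_prod_def)
    moreover have "1 - a * Q ^ 0 = 0" using True by simp
    ultimately show ?thesis unfolding has_prod_def by blast
  qed
  thus ?thesis using True by (simp add: qinf_def qpoch_inf_def has_prod_iff)
next
  case False
  from prodinf_split_head[OF qinf_convergent[of a]] False show ?thesis
    by (simp add: qinf_def qpoch_inf_def mult.assoc)
qed

lemma qinf_nz: "(\<And>k::nat. a * Q ^ k \<noteq> 1) \<Longrightarrow> qinf a \<noteq> 0"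
  unfolding qinf_def qpoch_inf_def by (intro prodinf_nonzero qinf_convergent) auto

lemma qinf_split: "qinf a = (\<Prod>i<k. 1 - a * Q ^ i) * qinf (a * Q ^ k)"
proof (induction k)
  case (Suc k)
  show ?case using Suc qinf_step[of "a * Q ^ k"] by (simp add: mult_ac)
qed simp

lemma qpoch_nat: "qpoch a q (int k) = (\<Prod>i<k. 1 - a * Q ^ i)"
  by (simp add: qpoch_def)

text \<open>
  For negative \<open>k\<close> the factorial is the reciprocal of a product, hence the hypothesis that this
  product does not vanish.
\<close>

lemma qpoch_mult_qinf:
  assumes "k < 0 \<Longrightarrow> (\<Prod>i<nat (- k). 1 - (a * Q powi k) * Q ^ i) \<noteq> 0"
  shows "qpoch a q k * qinf (a * Q powi k) = qinf a"
proof (cases "k < 0")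
  case True
  have "Q powi k * Q powi (- k) = 1" by (simp flip: power_int_add)
  hence "Q powi k * Q ^ nat (-k) = 1" using True by (simp add: power_int_def)
  hence e: "a * Q powi k * Q ^ nat (-k) = a" by (simp only: mult.assoc mult_1_right)
  thus ?thesis using qinf_split[of "a * Q powi k" "nat (-k)", unfolded e] True assms
    by (simp add: qpoch_def del: prod_zero_iff)
next
  case False
  thus ?thesis using qinf_split[of a "nat k"] by (simp add: qpoch_def power_int_def)
qed

text \<open>
  Reversal of a shifted factorial, in the form needed to turn a factor \<open>1 / (b; q)\<^sub>i\<^sub>-\<^sub>k\<close> of a
  Cauchy product into an upper parameter of a hypergeometric series.
\<close>

lemma qinf_reflect:
  assumes "c \<noteq> 0"
  shows "qinf (Q powi (1 - int k) / c)
         = qpoch c q (int k) * (- 1 / c) ^ k * Q powi (- (int k * (int k - 1) div 2)) * qinf (Q / c)"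
proof (induction k)
  case 0
  show ?case by (simp add: qpoch_def)
next
  case (Suc k)
  have e: "int (Suc k) * (int (Suc k) - 1) div 2 = int k * (int k - 1) div 2 + int k"
  proof -
    have "int (Suc k) * (int (Suc k) - 1) = int k * (int k - 1) + int k * 2"
      by (simp add: algebra_simps)
    thus ?thesis by (metis div_mult_self1 zero_neq_numeral add.commute mult.commute)
  qed
  have "Q powi (- int k) / c * Q = Q powi (1 - int k) / c"
    by (simp add: power_int_diff power_int_minus divide_inverse mult_ac)
  hence "qinf (Q powi (1 - int (Suc k)) / c) = (1 - Q powi (- int k) / c) * qinf (Q powi (1 - int k) / c)"
    using qinf_step[of "Q powi (- int k) / c"] by (simp del: times_divide_eq_left)
  also have "1 - Q powi (- int k) / c = (1 - c * Q ^ k) * (- 1 / c) * Q powi (- int k)"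
    using assms by (simp add: power_int_minus field_simps)
  finally show ?case unfolding Suc.IH e qpoch_nat
    by (simp add: power_int_add power_int_diff power_int_minus field_simps)
qed

definition inv_fact :: "nat \<Rightarrow> complex" where "inv_fact k = inverse (qpoch Q q (int k))"

lemma qpoch_Q_nz: "qpoch Q q (int k) \<noteq> 0"
  unfolding qpoch_nat using Q_power_Suc_neq_1 by auto

lemma inv_fact_0 [simp]: "inv_fact 0 = 1" by (simp add: inv_fact_def qpoch_def)

lemma inv_fact_Suc: "inv_fact k = (1 - Q ^ Suc k) * inv_fact (Suc k)"
  using qpoch_Q_nz[of k] qpoch_Q_nz[of "Suc k"]
  by (simp add: inv_fact_def qpoch_nat field_simps del: of_nat_Suc)

section \<open>Jackson's Bessel functions as formal power series\<close>

definition dilate :: "complex \<Rightarrow> complex fps \<Rightarrow> complex fps" where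
  "dilate c f = f oo (fps_const c * fps_X)"

lemma dilate_nth [simp]: "dilate c f $ k = c ^ k * f $ k"
  by (simp add: dilate_def)

lemma dilate_mult: "dilate c (f * g) = dilate c f * dilate c g"
  unfolding dilate_def by (rule fps_compose_mult_distrib) auto

lemma dilate_add: "dilate c (f + g) = dilate c f + dilate c g"
  and dilate_diff: "dilate c (f - g) = dilate c f - dilate c g"
  and dilate_const [simp]: "dilate c (fps_const d) = fps_const d"
  and dilate_1 [simp]: "dilate c 1 = 1"
  and dilate_X [simp]: "dilate c fps_X = fps_const c * fps_X"
  and dilate_dilate [simp]: "dilate c (dilate d f) = dilate (c * d) f"
  and dilate_one [simp]: "dilate 1 f = f"
  by (auto simp: fps_eq_iff algebra_simps power_mult_distrib fps_X_def)

text \<open>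
  With \<open>b = q\<^sup>\<nu>\<close> and the variable \<open>x\<^sup>2 / 4\<close>, these are Jackson's first and second
  \<open>q\<close>-Bessel functions without the factors \<open>(x / 2)\<^sup>\<nu>\<close> and \<open>1 / (q; q)\<^sub>\<infinity>\<close>.  Writing
  \<open>(b q\<^sup>k\<^sup>+\<^sup>1; q)\<^sub>\<infinity>\<close> for \<open>(b q; q)\<^sub>\<infinity> / (b q; q)\<^sub>k\<close> makes the coefficients entire in
  \<open>b\<close>, so that the relations below hold for every \<open>b\<close>.
\<close>

definition bessel1 :: "complex \<Rightarrow> complex fps" where
  "bessel1 b = Abs_fps (\<lambda>k. (- 1) ^ k * qinf (b * Q ^ Suc k) * inv_fact k)"

definition bessel2 :: "complex \<Rightarrow> complex fps" where
  "bessel2 b = Abs_fps (\<lambda>k. (- 1) ^ k * Q ^ (k\<^sup>2) * b ^ k * qinf (b * Q ^ Suc k) * inv_fact k)"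

lemma bessel2_up: "(1 + fps_X) * dilate Q (bessel2 b) = bessel2 b + fps_X * bessel2 (b * Q)"
proof (rule fps_ext)
  fix k show "((1 + fps_X) * dilate Q (bessel2 b)) $ k = (bessel2 b + fps_X * bessel2 (b * Q)) $ k"
  proof (cases k)
    case 0 thus ?thesis by (simp add: bessel2_def)
  next
    case (Suc l)
    have e: "Q ^ ((Suc l)\<^sup>2) = Q ^ (l\<^sup>2) * (Q ^ l)\<^sup>2 * Q"
      by (simp add: power2_eq_square algebra_simps flip: power_add)
    define w where "w = b * Q * Q ^ l"
    have "b * Q ^ Suc l = w" "b * Q ^ Suc (Suc l) = w * Q" "b * Q * Q ^ Suc l = w * Q"
      by (simp_all add: w_def mult_ac)
    note 1 = this
    show ?thesis unfolding Suc
      by (simp only: bessel2_def distrib_right mult_1 fps_add_nth fps_nth_Abs_fps fps_X_mult_nth dilate_nth 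
            nat.simps if_False diff_Suc_1 1 e inv_fact_Suc[of l] qinf_step[of w])
         (simp add: w_def field_simps power2_eq_square)
  qed
qed

lemma bessel2_down: "bessel2 b = fps_const b * dilate Q (bessel2 b) + dilate Q (bessel2 (b / Q))"
proof (rule fps_ext)
  fix k
  define w where "w = b * Q ^ k"
  have 1: "b * Q ^ Suc k = w * Q" "b / Q * Q ^ Suc k = w"
    by (simp_all add: w_def mult_ac)
  show "bessel2 b $ k = (fps_const b * dilate Q (bessel2 b) + dilate Q (bessel2 (b / Q))) $ k"
    by (simp only: bessel2_def fps_add_nth fps_nth_Abs_fps fps_mult_left_const_nth dilate_nth 1 qinf_step[of w])
       (simp add: w_def power_divide power_mult_distrib field_simps)
qed

text \<open>
  The three-term recurrence in the order; it is what remains after the dilated series is eliminated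
  from the two shift relations.
\<close>

lemma bessel2_contiguous:
  "fps_const (1 - b) * bessel2 b = fps_const b * fps_X * bessel2 (b * Q) + bessel2 (b / Q)"
proof -
  have "(1 + fps_X) * bessel2 b = fps_const b * ((1 + fps_X) * dilate Q (bessel2 b)) + (1 + fps_X) * dilate Q (bessel2 (b / Q))"
    by (subst bessel2_down) (simp add: algebra_simps)
  also have "\<dots> = fps_const b * (bessel2 b + fps_X * bessel2 (b * Q)) + (bessel2 (b / Q) + fps_X * bessel2 b)"
    by (simp only: bessel2_up) simp
  finally show ?thesis by (simp add: algebra_simps flip: fps_const_sub)
qed

lemma bessel1_up: "dilate Q (bessel1 b) = bessel1 b + fps_X * bessel1 (b * Q)"
proof (rule fps_ext)
  fix k show "dilate Q (bessel1 b) $ k = (bessel1 b + fps_X * bessel1 (b * Q)) $ k"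
  proof (cases k)
    case 0 thus ?thesis by (simp add: bessel1_def)
  next
    case (Suc l)
    have 1: "b * Q * Q ^ Suc l = b * Q ^ Suc (Suc l)" by (simp add: mult_ac)
    show ?thesis unfolding Suc
      by (simp only: bessel1_def distrib_right mult_1 fps_add_nth fps_nth_Abs_fps fps_X_mult_nth dilate_nth 
            nat.simps if_False diff_Suc_1 1 inv_fact_Suc[of l])
         (simp add: field_simps power2_eq_square)
  qed
qed

text \<open>
  Euler's expansion of \<open>(-z; q)\<^sub>\<infinity>\<close>, which enters through its functional equation.
\<close>

definition euler :: "complex fps" where
  "euler = Abs_fps (\<lambda>k. Q ^ (k * (k - 1) div 2) * inv_fact k)"

lemma euler_0 [simp]: "euler $ 0 = 1" by (simp add: euler_def)

lemma euler_nz [simp]: "euler \<noteq> 0" by (metis euler_0 fps_zero_nth zero_neq_one)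

lemma euler_dilate: "(1 + fps_X) * dilate Q euler = euler"
proof (rule fps_ext)
  fix k show "((1 + fps_X) * dilate Q euler) $ k = euler $ k"
  proof (cases k)
    case 0 thus ?thesis by (simp add: euler_def)
  next
    case (Suc l)
    have "Suc l * l = l * (l - 1) + l * 2" by (cases l) simp_all
    hence "Suc l * l div 2 = l * (l - 1) div 2 + l" by simp
    hence e: "Q ^ (Suc l * l div 2) = Q ^ (l * (l - 1) div 2) * Q ^ l"
      by (simp only: power_add)
    show ?thesis unfolding Suc
      by (simp only: euler_def distrib_right mult_1 fps_add_nth fps_nth_Abs_fps fps_X_mult_nth dilate_nth 
            nat.simps if_False diff_Suc_1 e inv_fact_Suc[of l])
         (simp add: field_simps)
  qed
qed

lemma euler_unique:
  assumes "(1 + fps_X) * dilate Q f = f"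
  shows "f = fps_const (f $ 0) * euler"
proof (rule fps_ext)
  fix k show "f $ k = (fps_const (f $ 0) * euler) $ k"
  proof (induction k)
    case 0 show ?case by simp
  next
    case (Suc l)
    have "((1 + fps_X) * dilate Q f) $ Suc l = f $ Suc l" using assms by simp
    hence 1: "(1 - Q ^ Suc l) * f $ Suc l = Q ^ l * f $ l" by (simp add: algebra_simps)
    have "((1 + fps_X) * dilate Q euler) $ Suc l = euler $ Suc l" using euler_dilate by simp
    hence 2: "(1 - Q ^ Suc l) * euler $ Suc l = Q ^ l * euler $ l" by (simp add: algebra_simps)
    have "(1 - Q ^ Suc l) * f $ Suc l = (1 - Q ^ Suc l) * (f $ 0 * euler $ Suc l)"
      using 1 2 Suc by (simp only: mult.left_commute[of _ "f $ 0"]) (simp add: mult_ac)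
    thus ?case using Q_power_Suc_neq_1[of l] by simp
  qed
qed

text \<open>
  Both sides solve \<open>(1 + z) f\<^sub>b(q z) = f\<^sub>b(z) + z f\<^sub>b\<^sub>q(z)\<close>, and this relation determines all
  coefficients from the constant ones because \<open>1 - q\<^sup>k \<noteq> 0\<close> for \<open>k \<ge> 1\<close>.
\<close>

lemma bessel2_eq_euler_bessel1: "bessel2 b = euler * bessel1 b"
proof (rule fps_ext)
  have up: "(1 + fps_X) * dilate Q (euler * bessel1 b) = euler * bessel1 b + fps_X * (euler * bessel1 (b * Q))" for b
  proof -
    have "(1 + fps_X) * dilate Q (euler * bessel1 b) = ((1 + fps_X) * dilate Q euler) * dilate Q (bessel1 b)"
      by (simp add: dilate_mult)
    also have "\<dots> = euler * bessel1 b + fps_X * (euler * bessel1 (b * Q))"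
      unfolding euler_dilate bessel1_up by (simp add: algebra_simps)
    finally show ?thesis .
  qed
  fix k show "bessel2 b $ k = (euler * bessel1 b) $ k"
  proof (induction k arbitrary: b)
    case 0 show ?case by (simp add: bessel1_def bessel2_def)
  next
    case (Suc l)
    have "((1 + fps_X) * dilate Q (bessel2 b)) $ Suc l = (bessel2 b + fps_X * bessel2 (b * Q)) $ Suc l" using bessel2_up by simp
    hence 1: "(1 - Q ^ Suc l) * bessel2 b $ Suc l = Q ^ l * bessel2 b $ l - bessel2 (b * Q) $ l" by (simp add: algebra_simps)
    have "((1 + fps_X) * dilate Q (euler * bessel1 b)) $ Suc l = (euler * bessel1 b + fps_X * (euler * bessel1 (b * Q))) $ Suc l"
      using up by simp
    hence 2: "(1 - Q ^ Suc l) * (euler * bessel1 b) $ Suc l = Q ^ l * (euler * bessel1 b) $ l - (euler * bessel1 (b * Q)) $ l"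
      by (simp only: distrib_right mult_1 fps_add_nth fps_X_mult_nth dilate_nth nat.simps if_False diff_Suc_1)
         (simp add: algebra_simps)
    have "(1 - Q ^ Suc l) * bessel2 b $ Suc l = (1 - Q ^ Suc l) * (euler * bessel1 b) $ Suc l"
      unfolding 1 2 Suc ..
    thus ?case using Q_power_Suc_neq_1[of l] unfolding mult_cancel_left by auto
  qed
qed

section \<open>Reduction of a contiguous family to two of its members\<close>

text \<open>
  The family of Bessel functions involves all integral powers of \<open>z\<close>, so its members are taken
  in the field of Laurent series.  Constants and the variable enter through the same embedding as
  polynomials, which leaves only ring homomorphism laws to compute with.
\<close>

definition emb :: "complex poly \<Rightarrow> complex fls" where "emb p = fps_to_fls (fps_of_poly p)"

abbreviation cst :: "complex \<Rightarrow> complex fls" where "cst c \<equiv> emb [:c:]"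
definition zvar :: "complex fls" where "zvar = emb [:0, 1:]"

lemma emb_mult: "emb (p * r) = emb p * emb r"
  by (simp add: emb_def fps_of_poly_mult fls_times_fps_to_fls)

lemma emb_add: "emb (p + r) = emb p + emb r"
  by (simp add: emb_def fps_of_poly_add)

lemma emb_0 [simp]: "emb 0 = 0" and emb_1 [simp]: "emb 1 = 1"
  by (simp_all add: emb_def)

lemma cst_mult: "cst (c * d) = cst c * cst d" using emb_mult[of "[:c:]" "[:d:]"] by (simp add: mult.commute)
lemma cst_add: "cst (c + d) = cst c + cst d" using emb_add[of "[:c:]" "[:d:]"] by simp
lemma cst_diff: "cst (c - d) = cst c - cst d" using cst_add[of "c - d" d] by simp
lemma cst_1 [simp]: "cst 1 = 1" using emb_1 by (simp add: one_pCons)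
lemma cst_minus: "cst (- c) = - cst c" using cst_diff[of 0 c] by simp

lemma cst_inverse: "c \<noteq> 0 \<Longrightarrow> cst (1 / c) * cst c = 1"
  by (simp flip: cst_mult)

lemma zvar_nz [simp]: "zvar \<noteq> 0" by (simp add: zvar_def emb_def)

lemma emb_monom: "emb (monom c s) = cst c * zvar ^ s"
proof (induction s)
  case 0 show ?case by (simp add: monom_0)
next
  case (Suc s)
  have "monom c (Suc s) = [:0, 1:] * monom c s" by (simp add: monom_Suc)
  thus ?case by (simp only: emb_mult Suc zvar_def power_Suc mult_ac)
qed

lemma emb_linear: "emb [:1, c:] = 1 + cst c * zvar"
proof -
  have "[:1, c:] = 1 + [:c:] * [:0, 1:]" by (simp add: one_pCons)
  thus ?thesis by (simp only: emb_add emb_mult zvar_def emb_1)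
qed

text \<open>
  The polynomial \<open>(-z; q)\<^sub>k\<close> with \<open>k = max n 0\<close>, the denominator that accumulates when \<open>n\<close> increases.
\<close>

definition Epoly :: "int \<Rightarrow> complex poly" where
  "Epoly n = (\<Prod>i<nat n. [:1, Q ^ i:])"

lemma Epoly_nonpos: "n \<le> 0 \<Longrightarrow> Epoly n = 1" by (simp add: Epoly_def)

lemma Epoly_Suc: "n \<ge> 0 \<Longrightarrow> Epoly (n + 1) = Epoly n * [:1, Q powi n:]"
  by (simp add: Epoly_def nat_add_distrib power_int_def)

text \<open>
  The relations satisfied by \<open>z\<^sup>m\<close> times the normalised Bessel function of order
  \<open>\<nu> + m\<close> at \<open>q\<^sup>n z\<close>.  The first allows a step to larger \<open>n\<close>, the second to
  smaller \<open>n\<close>; together they also give the recurrence in \<open>m\<close>.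
\<close>

definition contiguous :: "complex \<Rightarrow> (int \<Rightarrow> int \<Rightarrow> complex fls) \<Rightarrow> bool" where
  "contiguous a h \<longleftrightarrow>
     (\<forall>m n. (1 + cst (Q powi n) * zvar) * h m (n + 1) = h m n + cst (Q powi n) * h (m + 1) n) \<and>
     (\<forall>m n. h m n = cst (a * Q powi m) * h m (n + 1) + zvar * h (m - 1) (n + 1))"

lemma contiguous_three_term:
  assumes "contiguous a h"
  shows "cst (1 - a * Q powi m) * h m 0 = cst (a * Q powi m) * h (m + 1) 0 + zvar * h (m - 1) 0"
proof -
  have up: "(1 + zvar) * h k 1 = h k 0 + h (k + 1) 0" for k
    using assms unfolding contiguous_def by (metis cst_1 add_0 mult_1 power_int_0_right)
  have dn: "h m 0 = cst (a * Q powi m) * h m 1 + zvar * h (m - 1) 1"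
    using assms unfolding contiguous_def by (metis add_0)
  have "(1 + zvar) * h m 0 = cst (a * Q powi m) * ((1 + zvar) * h m 1) + zvar * ((1 + zvar) * h (m - 1) 1)"
    by (subst dn) (simp add: algebra_simps)
  also have "\<dots> = cst (a * Q powi m) * (h m 0 + h (m + 1) 0) + zvar * (h (m - 1) 0 + h m 0)"
    by (simp only: up diff_add_cancel)
  finally show ?thesis by (simp add: cst_diff algebra_simps)
qed

text \<open>
  Families of polynomials with a bound on twice the degree.  The bound is an integer so that a negative
  bound forces the polynomial to vanish.  Continuity in the parameter is carried along for the passage
  to exceptional orders.
\<close>

definition bounded_family :: "int \<Rightarrow> (complex \<Rightarrow> complex poly) \<Rightarrow> bool" where
  "bounded_family d S \<longleftrightarrow> (\<forall>a k. coeff (S a) k \<noteq> 0 \<longrightarrow> 2 * int k \<le> d) \<and>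
     (\<forall>k. continuous_on (- {0}) (\<lambda>a. coeff (S a) k))"

lemma bounded_family_combine:
  assumes "bounded_family d1 S1" "bounded_family d2 S2" "continuous_on (- {0}) \<alpha>" "continuous_on (- {0}) \<beta>"
    and "d1 + 2 * int s1 \<le> d" "d2 + 2 * int s2 \<le> d"
  shows "bounded_family d (\<lambda>a. monom (\<alpha> a) s1 * S1 a + monom (\<beta> a) s2 * S2 a)"
  unfolding bounded_family_def
proof (intro conjI allI impI)
  fix a k assume "coeff (monom (\<alpha> a) s1 * S1 a + monom (\<beta> a) s2 * S2 a) k \<noteq> 0"
  hence "s1 \<le> k \<and> coeff (S1 a) (k - s1) \<noteq> 0 \<or> s2 \<le> k \<and> coeff (S2 a) (k - s2) \<noteq> 0"
    by (auto simp: coeff_monom_mult split: if_splits)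
  thus "2 * int k \<le> d" using assms unfolding bounded_family_def by fastforce
next
  fix k
  show "continuous_on (- {0}) (\<lambda>a. coeff (monom (\<alpha> a) s1 * S1 a + monom (\<beta> a) s2 * S2 a) k)"
    using assms unfolding bounded_family_def coeff_add coeff_monom_mult
    by (cases "s1 \<le> k"; cases "s2 \<le> k") (auto intro!: continuous_intros)
qed

definition neg_ind :: "int \<Rightarrow> nat" where "neg_ind m = (if m < 0 then 1 else 0)"

text \<open>
  The family \<open>h\<close> is quantified inside, so one pair \<open>S\<close>, \<open>T\<close> serves all solutions; Cramer's
  rule depends on this.  For \<open>m < 0\<close> the coefficient of \<open>h 0 0\<close> is divisible by \<open>z\<close>.
  This factor is split off as \<open>zvar ^ neg_ind m\<close>, which makes the degree bounds for \<open>S\<close> and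
  \<open>T\<close> symmetric: they are the same function of \<open>m + 1\<close> and of \<open>m\<close>.
\<close>

definition reduces_by :: "int \<Rightarrow> int \<Rightarrow> (complex \<Rightarrow> complex poly) \<Rightarrow> (complex \<Rightarrow> complex poly) \<Rightarrow> bool" where
  "reduces_by m n S T \<longleftrightarrow> bounded_family (\<bar>m + 1\<bar> + \<bar>n\<bar> - 1) S \<and> bounded_family (\<bar>m\<bar> + \<bar>n\<bar> - 1) T \<and>
     (\<forall>a h. a \<noteq> 0 \<longrightarrow> contiguous a h \<longrightarrow>
        zvar ^ nat (- m) * emb (Epoly n) * h m n
        = zvar ^ neg_ind m * emb (S a) * h 0 0 + zvar * emb (T a) * h (- 1) 0)"

definition reducible :: "int \<Rightarrow> int \<Rightarrow> bool" where
  "reducible m n \<longleftrightarrow> (\<exists>S T. reduces_by m n S T)"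

text \<open>
  Common form of all steps of the walk.  The numbers \<open>i1\<close> and \<open>i2\<close> are the powers of \<open>z\<close>
  that the two known members acquire, hence the degrees added to \<open>T\<close>; those added to \<open>S\<close> are
  \<open>s1\<close> and \<open>s2\<close>, which differ from them by the power split off for negative first indices.
\<close>

lemma reducible_combine:
  assumes R1: "reducible m1 n1" and R2: "reducible m2 n2"
    and c: "continuous_on (- {0}) \<alpha>" "continuous_on (- {0}) \<beta>"
    and s: "s1 + neg_ind m = i1 + neg_ind m1" "s2 + neg_ind m = i2 + neg_ind m2"
    and d: "\<bar>m1 + 1\<bar> + \<bar>n1\<bar> + 2 * int s1 \<le> \<bar>m + 1\<bar> + \<bar>n\<bar>"
           "\<bar>m2 + 1\<bar> + \<bar>n2\<bar> + 2 * int s2 \<le> \<bar>m + 1\<bar> + \<bar>n\<bar>"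
           "\<bar>m1\<bar> + \<bar>n1\<bar> + 2 * int i1 \<le> \<bar>m\<bar> + \<bar>n\<bar>"
           "\<bar>m2\<bar> + \<bar>n2\<bar> + 2 * int i2 \<le> \<bar>m\<bar> + \<bar>n\<bar>"
    and rel: "\<And>a h. a \<noteq> 0 \<Longrightarrow> contiguous a h \<Longrightarrow> zvar ^ nat (- m) * emb (Epoly n) * h m n
        = cst (\<alpha> a) * zvar ^ i1 * (zvar ^ nat (- m1) * emb (Epoly n1) * h m1 n1)
        + cst (\<beta> a) * zvar ^ i2 * (zvar ^ nat (- m2) * emb (Epoly n2) * h m2 n2)"
  shows "reducible m n"
proof -
  obtain S1 T1 where 1: "reduces_by m1 n1 S1 T1" using R1 by (auto simp: reducible_def)
  obtain S2 T2 where 2: "reduces_by m2 n2 S2 T2" using R2 by (auto simp: reducible_def)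
  define S where "S = (\<lambda>a. monom (\<alpha> a) s1 * S1 a + monom (\<beta> a) s2 * S2 a)"
  define T where "T = (\<lambda>a. monom (\<alpha> a) i1 * T1 a + monom (\<beta> a) i2 * T2 a)"
  have "bounded_family (\<bar>m + 1\<bar> + \<bar>n\<bar> - 1) S" unfolding S_def
    by (rule bounded_family_combine[where ?d1.0 = "\<bar>m1 + 1\<bar> + \<bar>n1\<bar> - 1" and ?d2.0 = "\<bar>m2 + 1\<bar> + \<bar>n2\<bar> - 1"])
       (use 1 2 c d in \<open>auto simp: reduces_by_def\<close>)
  moreover have "bounded_family (\<bar>m\<bar> + \<bar>n\<bar> - 1) T" unfolding T_def
    by (rule bounded_family_combine[where ?d1.0 = "\<bar>m1\<bar> + \<bar>n1\<bar> - 1" and ?d2.0 = "\<bar>m2\<bar> + \<bar>n2\<bar> - 1"])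
       (use 1 2 c d in \<open>auto simp: reduces_by_def\<close>)
  moreover have "zvar ^ nat (- m) * emb (Epoly n) * h m n
        = zvar ^ neg_ind m * emb (S a) * h 0 0 + zvar * emb (T a) * h (- 1) 0" if a: "a \<noteq> 0" "contiguous a h" for a h
  proof -
    have p: "zvar ^ i1 * zvar ^ neg_ind m1 = zvar ^ s1 * zvar ^ neg_ind m" "zvar ^ i2 * zvar ^ neg_ind m2 = zvar ^ s2 * zvar ^ neg_ind m"
      by (simp_all only: s flip: power_add)
    have "zvar ^ nat (- m) * emb (Epoly n) * h m n
      = cst (\<alpha> a) * zvar ^ i1 * (zvar ^ neg_ind m1 * emb (S1 a) * h 0 0 + zvar * emb (T1 a) * h (- 1) 0)
        + cst (\<beta> a) * zvar ^ i2 * (zvar ^ neg_ind m2 * emb (S2 a) * h 0 0 + zvar * emb (T2 a) * h (- 1) 0)"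
      unfolding rel[OF a] using 1 2 a by (simp add: reduces_by_def)
    also have "\<dots> = (cst (\<alpha> a) * (zvar ^ i1 * zvar ^ neg_ind m1) * emb (S1 a) + cst (\<beta> a) * (zvar ^ i2 * zvar ^ neg_ind m2) * emb (S2 a)) * h 0 0
        + (cst (\<alpha> a) * zvar ^ i1 * emb (T1 a) + cst (\<beta> a) * zvar ^ i2 * emb (T2 a)) * zvar * h (- 1) 0"
      by (simp add: algebra_simps)
    also have "\<dots> = zvar ^ neg_ind m * emb (S a) * h 0 0 + zvar * emb (T a) * h (- 1) 0"
      unfolding p by (simp add: S_def T_def emb_add emb_mult emb_monom algebra_simps)
    finally show ?thesis .
  qed
  ultimately show ?thesis unfolding reducible_def reduces_by_def by blast
qed

lemma reducible_0_0: "reducible 0 0"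
proof -
  have "reduces_by 0 0 (\<lambda>_. 1) (\<lambda>_. 0)"
    by (simp add: reduces_by_def bounded_family_def Epoly_nonpos neg_ind_def coeff_1)
  thus ?thesis unfolding reducible_def by blast
qed

lemma reducible_m1_0: "reducible (- 1) 0"
proof -
  have "reduces_by (- 1) 0 (\<lambda>_. 0) (\<lambda>_. 1)"
    by (simp add: reduces_by_def bounded_family_def Epoly_nonpos neg_ind_def coeff_1)
  thus ?thesis unfolding reducible_def by blast
qed

text \<open>
  In the four step lemmas the case distinctions among the exponents record where the step crosses
  between \<open>m = -1\<close> and \<open>m = 0\<close>: there the powers of \<open>z\<close> by which \<open>reduces_by\<close>
  normalises negative first indices change.
\<close>

lemma reducible_up:
  assumes "m \<ge> 0" "reducible m 0" "reducible (m - 1) 0"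
  shows "reducible (m + 1) 0"
proof (rule reducible_combine[OF assms(2,3)])
  show "continuous_on (- {0}) (\<lambda>a. (1 - a * Q powi m) / (a * Q powi m))"
    by (auto intro!: continuous_intros)
  show "continuous_on (- {0}) (\<lambda>a. - (1 / (a * Q powi m)))"
    by (auto intro!: continuous_intros)
  show "(0::nat) + neg_ind (m + 1) = 0 + neg_ind m" using assms by (simp add: neg_ind_def)
  show "1 + neg_ind (m + 1) = (if m = 0 then 0 else 1) + neg_ind (m - 1)"
    using assms by (simp add: neg_ind_def)
  fix a h assume a: "a \<noteq> 0" "contiguous a h"
  have b: "a * Q powi m \<noteq> 0" using a by simp
  have e: "(if m = 0 then 0 else 1) + nat (- (m - 1)) = 1" using assms by simp
  have "h (m + 1) 0 = cst (1 / (a * Q powi m)) * (cst (a * Q powi m) * h (m + 1) 0)"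
    by (simp only: mult.assoc[symmetric] cst_inverse[OF b]) simp
  also have "\<dots> = cst (1 / (a * Q powi m)) * (cst (1 - a * Q powi m) * h m 0 - zvar * h (m - 1) 0)"
    by (simp add: contiguous_three_term[OF a(2)])
  also have "\<dots> = cst ((1 - a * Q powi m) / (a * Q powi m)) * h m 0 + cst (- (1 / (a * Q powi m))) * zvar * h (m - 1) 0"
    using cst_mult[of "1 / (a * Q powi m)" "1 - a * Q powi m"] by (simp add: algebra_simps cst_minus)
  finally have 1: "h (m + 1) 0 = cst ((1 - a * Q powi m) / (a * Q powi m)) * h m 0
      + cst (- (1 / (a * Q powi m))) * (zvar ^ (if m = 0 then 0 else 1) * zvar ^ nat (- (m - 1))) * h (m - 1) 0"
    by (simp only: e flip: power_add) simp
  show "zvar ^ nat (- (m + 1)) * emb (Epoly 0) * h (m + 1) 0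
    = cst ((1 - a * Q powi m) / (a * Q powi m)) * zvar ^ 0 * (zvar ^ nat (- m) * emb (Epoly 0) * h m 0)
      + cst (- (1 / (a * Q powi m))) * zvar ^ (if m = 0 then 0 else 1) * (zvar ^ nat (- (m - 1)) * emb (Epoly 0) * h (m - 1) 0)"
    using assms(1) by (simp only: Epoly_nonpos order_refl emb_1) (use 1 in \<open>simp add: mult.assoc\<close>)
qed (use assms in auto)

lemma reducible_down:
  assumes "m \<le> - 1" "reducible m 0" "reducible (m + 1) 0"
  shows "reducible (m - 1) 0"
proof (rule reducible_combine[OF assms(2,3)])
  show "continuous_on (- {0}) (\<lambda>a. 1 - a * Q powi m)"
    by (auto intro!: continuous_intros)
  show "continuous_on (- {0}) (\<lambda>a. - (a * Q powi m))"
    by (auto intro!: continuous_intros)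
  show "(0::nat) + neg_ind (m - 1) = 0 + neg_ind m" using assms by (simp add: neg_ind_def)
  show "(if m = - 1 then 0 else 1) + neg_ind (m - 1) = 1 + neg_ind (m + 1)"
    using assms by (auto simp add: neg_ind_def)
  fix a h assume a: "a \<noteq> 0" "contiguous a h"
  have e: "nat (- (m - 1)) = Suc (nat (- m))" "nat (- m) = 1 + nat (- (m + 1))" using assms by auto
  have 1: "zvar * h (m - 1) 0 = cst (1 - a * Q powi m) * h m 0 + cst (- (a * Q powi m)) * h (m + 1) 0"
    by (simp add: contiguous_three_term[OF a(2)] cst_minus)
  have "zvar ^ nat (- (m - 1)) * h (m - 1) 0 = zvar ^ nat (- m) * (zvar * h (m - 1) 0)"
    by (simp only: e(1) power_Suc mult_ac)
  also have "\<dots> = cst (1 - a * Q powi m) * (zvar ^ nat (- m) * h m 0) + cst (- (a * Q powi m)) * zvar ^ nat (- m) * h (m + 1) 0"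
    unfolding 1 by (simp add: algebra_simps)
  finally show "zvar ^ nat (- (m - 1)) * emb (Epoly 0) * h (m - 1) 0
    = cst (1 - a * Q powi m) * zvar ^ 0 * (zvar ^ nat (- m) * emb (Epoly 0) * h m 0)
      + cst (- (a * Q powi m)) * zvar ^ 1 * (zvar ^ nat (- (m + 1)) * emb (Epoly 0) * h (m + 1) 0)"
    by (simp only: Epoly_nonpos order_refl emb_1 e(2) power_add) simp
qed (use assms in auto)

lemma reducible_n_up:
  assumes "n \<ge> 0" "reducible m n" "reducible (m + 1) n"
  shows "reducible m (n + 1)"
proof (rule reducible_combine[OF assms(2,3)])
  show "continuous_on (- {0}) (\<lambda>a::complex. 1 :: complex)" "continuous_on (- {0}) (\<lambda>a::complex. Q powi n)"
    by (auto intro!: continuous_intros)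
  show "(0::nat) + neg_ind m = 0 + neg_ind m" by simp
  show "(if m < -1 then 1 else 0) + neg_ind m = (if m < 0 then 1 else 0) + neg_ind (m + 1)"
    by (auto simp add: neg_ind_def)
  fix a h assume a: "a \<noteq> 0" "contiguous a h"
  have e: "nat (- m) = (if m < 0 then 1 else 0) + nat (- (m + 1))" by auto
  have 1: "(1 + cst (Q powi n) * zvar) * h m (n + 1) = h m n + cst (Q powi n) * h (m + 1) n"
    using a(2) unfolding contiguous_def by blast
  have "zvar ^ nat (- m) * emb (Epoly (n + 1)) * h m (n + 1)
     = zvar ^ nat (- m) * emb (Epoly n) * ((1 + cst (Q powi n) * zvar) * h m (n + 1))"
    by (simp only: Epoly_Suc[OF assms(1)] emb_mult emb_linear mult_ac)
  also have "\<dots> = zvar ^ nat (- m) * emb (Epoly n) * h m n + cst (Q powi n) * zvar ^ nat (- m) * emb (Epoly n) * h (m + 1) n"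
    unfolding 1 by (simp add: algebra_simps)
  also have "cst (Q powi n) * zvar ^ nat (- m) * emb (Epoly n) * h (m + 1) n
     = cst (Q powi n) * zvar ^ (if m < 0 then 1 else 0) * (zvar ^ nat (- (m + 1)) * emb (Epoly n) * h (m + 1) n)"
    unfolding e power_add by (simp only: mult.assoc)
  finally show "zvar ^ nat (- m) * emb (Epoly (n + 1)) * h m (n + 1)
    = cst 1 * zvar ^ 0 * (zvar ^ nat (- m) * emb (Epoly n) * h m n)
      + cst (Q powi n) * zvar ^ (if m < 0 then 1 else 0) * (zvar ^ nat (- (m + 1)) * emb (Epoly n) * h (m + 1) n)"
    by (simp only: cst_1 mult_1 power_0)
qed (use assms in \<open>simp_all add: abs_if split: if_splits\<close>)

lemma reducible_n_down:
  assumes "n < 0" "reducible m (n + 1)" "reducible (m - 1) (n + 1)"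
  shows "reducible m n"
proof (rule reducible_combine[OF assms(2,3)])
  show "continuous_on (- {0}) (\<lambda>a. a * Q powi m)" "continuous_on (- {0}) (\<lambda>a::complex. 1 :: complex)"
    by (auto intro!: continuous_intros)
  show "(0::nat) + neg_ind m = 0 + neg_ind m" by simp
  show "(if m \<ge> 0 then 1 else 0) + neg_ind m = (if m \<ge> 1 then 1 else 0) + neg_ind (m - 1)"
    by (auto simp add: neg_ind_def)
  fix a h assume a: "a \<noteq> 0" "contiguous a h"
  have e: "nat (- m) + 1 = (if m \<ge> 1 then 1 else 0) + nat (- (m - 1))" by auto
  have 1: "h m n = cst (a * Q powi m) * h m (n + 1) + zvar * h (m - 1) (n + 1)"
    using a(2) unfolding contiguous_def by blast
  have "zvar ^ nat (- m) * h m n = cst (a * Q powi m) * (zvar ^ nat (- m) * h m (n + 1))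
      + zvar ^ (nat (- m) + 1) * h (m - 1) (n + 1)"
    by (subst 1) (simp add: algebra_simps)
  also have "zvar ^ (nat (- m) + 1) = zvar ^ (if m \<ge> 1 then 1 else 0) * zvar ^ nat (- (m - 1))"
    unfolding e power_add ..
  finally show "zvar ^ nat (- m) * emb (Epoly n) * h m n
    = cst (a * Q powi m) * zvar ^ 0 * (zvar ^ nat (- m) * emb (Epoly (n + 1)) * h m (n + 1))
      + cst 1 * zvar ^ (if m \<ge> 1 then 1 else 0) * (zvar ^ nat (- (m - 1)) * emb (Epoly (n + 1)) * h (m - 1) (n + 1))"
    using assms(1) by (simp only: Epoly_nonpos[of n] Epoly_nonpos[of "n + 1"] less_imp_le zless_imp_add1_zle 
        emb_1 cst_1 mult_1 power_0 mult_1_right mult.assoc)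
qed (use assms in \<open>simp_all add: abs_if split: if_splits\<close>)

text \<open>
  The axis \<open>n = 0\<close> is reached by the three-term recurrence, everything else from it by the shifts
  in \<open>n\<close>.
\<close>

theorem reducible_all: "reducible m n"
proof -
  have up: "reducible (int k) 0 \<and> reducible (int k - 1) 0" for k
  proof (induction k)
    case (Suc k)
    have "int (Suc k) = int k + 1" "int k + 1 - 1 = int k" by auto
    thus ?case using reducible_up[of "int k"] Suc by (metis of_nat_0_le_iff)
  qed (use reducible_0_0 reducible_m1_0 in simp)
  have dn: "reducible (- 1 - int k) 0 \<and> reducible (- int k) 0" for k
  proof (induction k)
    case (Suc k) 
    have "- 1 - int (Suc k) = (- 1 - int k) - 1" "- int (Suc k) = - 1 - int k" "- int k = (- 1 - int k) + 1"
      "- 1 - int k \<le> - 1" by auto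
    thus ?case using reducible_down[of "- 1 - int k"] Suc by metis
  qed (use reducible_0_0 reducible_m1_0 in simp)
  have base: "reducible m 0" for m
    using up[of "nat m"] dn[of "nat (- m)"] by (cases "m \<ge> 0") auto
  have "reducible m (int k)" for k m
  proof (induction k arbitrary: m)
    case (Suc k)
    have "int (Suc k) = int k + 1" by simp
    thus ?case using reducible_n_up[of "int k" m] Suc by (metis of_nat_0_le_iff)
  qed (use base in simp)
  moreover have "reducible m (- int k)" for k m
  proof (induction k arbitrary: m)
    case (Suc k) 
    have "- int (Suc k) + 1 = - int k" "- int (Suc k) < 0" by auto
    thus ?case using reducible_n_down[of "- int (Suc k)" m] Suc by metis
  qed (use base in simp)
  ultimately show ?thesis by (metis int_cases2)
qed

section \<open>Two solutions and their Casoratian\<close>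

(* Keeps constants and the variable in the form in which the embedding of polynomials produces them. *)
declare fps_X_to_fls [simp del] fps_const_to_fls [simp del]

abbreviation to_fls :: "complex fps \<Rightarrow> complex fls" where "to_fls \<equiv> fps_to_fls"

lemma cst_eq: "cst c = to_fls (fps_const c)"
  by (simp add: emb_def fps_of_poly_const)

lemma zvar_eq: "zvar = to_fls fps_X"
  by (simp add: emb_def zvar_def)

lemma to_fls_mult: "to_fls (f * g) = to_fls f * to_fls g"
  by (simp add: fls_times_fps_to_fls)

lemma bessel2_up_dilated:
  "(1 + fps_const (Q powi n) * fps_X) * dilate (Q powi (n + 1)) (bessel2 b)
   = dilate (Q powi n) (bessel2 b) + fps_const (Q powi n) * fps_X * dilate (Q powi n) (bessel2 (b * Q))"
  using arg_cong[OF bessel2_up[of b], of "dilate (Q powi n)"] by (simp add: dilate_mult dilate_add power_int_add)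

lemma bessel2_down_dilated:
  "dilate (Q powi n) (bessel2 b) = fps_const b * dilate (Q powi (n + 1)) (bessel2 b) + dilate (Q powi (n + 1)) (bessel2 (b / Q))"
  using arg_cong[OF bessel2_down[of b], of "dilate (Q powi n)"] by (simp add: dilate_mult dilate_add power_int_add)

text \<open>
  The functions \<open>J\<^sub>-\<^sub>\<nu>\<^sub>-\<^sub>m\<close> move in the opposite direction when \<open>m\<close> grows.  This relation and
  \<open>bessel2_down_inverse\<close> restate the two shift relations with \<open>c\<close> and \<open>c / q\<close> in place of
  \<open>b\<close> and \<open>b q\<close>, and vice versa.
\<close>

lemma bessel2_up_inverse: "fps_const c * ((1 + fps_X) * dilate Q (bessel2 c)) = bessel2 c - bessel2 (c / Q)"
  unfolding bessel2_up using bessel2_contiguous[of c] by (simp add: algebra_simps flip: fps_const_sub)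

lemma bessel2_up_inverse_dilated:
  "fps_const c * ((1 + fps_const (Q powi n) * fps_X) * dilate (Q powi (n + 1)) (bessel2 c))
   = dilate (Q powi n) (bessel2 c) - dilate (Q powi n) (bessel2 (c / Q))"
  using arg_cong[OF bessel2_up_inverse[of c], of "dilate (Q powi n)"] by (simp add: dilate_mult dilate_add dilate_diff power_int_add)

lemma bessel2_contiguous_dilated:
  "dilate Q (bessel2 c) = fps_const c * dilate Q (bessel2 c) + fps_const (c * Q) * fps_X * dilate Q (bessel2 (c * Q)) + dilate Q (bessel2 (c / Q))"
proof -
  have "fps_const (1 - c) * dilate Q (bessel2 c) = fps_const c * (fps_const Q * fps_X) * dilate Q (bessel2 (c * Q)) + dilate Q (bessel2 (c / Q))"
    using arg_cong[OF bessel2_contiguous[of c], of "dilate Q"] by (simp add: dilate_mult dilate_add)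
  thus ?thesis by (simp add: algebra_simps flip: fps_const_sub fps_const_mult)
qed

lemma bessel2_down_inverse: "bessel2 c = dilate Q (bessel2 c) - fps_const (c * Q) * fps_X * dilate Q (bessel2 (c * Q))"
proof -
  have "bessel2 c = fps_const c * dilate Q (bessel2 c) + dilate Q (bessel2 (c / Q))" by (rule bessel2_down)
  also have "\<dots> = dilate Q (bessel2 c) - fps_const (c * Q) * fps_X * dilate Q (bessel2 (c * Q))"
    by (subst (2) bessel2_contiguous_dilated) simp
  finally show ?thesis .
qed

lemma bessel2_down_inverse_dilated:
  "dilate (Q powi n) (bessel2 c) = dilate (Q powi (n + 1)) (bessel2 c)
     - fps_const (c * Q powi (n + 1)) * fps_X * dilate (Q powi (n + 1)) (bessel2 (c * Q))"
proof -
  have "dilate (Q powi n) (fps_const (c * Q) * fps_X * dilate Q (bessel2 (c * Q))) =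
     fps_const (c * Q) * (fps_const (Q powi n) * fps_X) * dilate (Q powi n * Q) (bessel2 (c * Q))"
    by (simp add: dilate_mult)
  also have "\<dots> = fps_const (c * Q powi (n + 1)) * fps_X * dilate (Q powi (n + 1)) (bessel2 (c * Q))"
    by (simp add: power_int_add mult_ac flip: fps_const_mult)
  finally show ?thesis
    using arg_cong[OF bessel2_down_inverse[of c], of "dilate (Q powi n)"] by (simp add: dilate_diff power_int_add)
qed

lemma zvar_clear: "zvar ^ nat (- m) * zvar powi m = zvar ^ nat m"
  by (auto simp: power_int_def power_inverse)

definition sol_pos :: "complex \<Rightarrow> int \<Rightarrow> int \<Rightarrow> complex fls" where
  "sol_pos a m n = zvar powi m * to_fls (dilate (Q powi n) (bessel2 (a * Q powi m)))"

text \<open>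
  The normalisation under which \<open>J\<^sub>-\<^sub>\<nu>\<^sub>-\<^sub>m(x q\<^sup>n\<^sup>/\<^sup>2)\<close> satisfies the relations of
  \<open>J\<^sub>\<nu>\<^sub>+\<^sub>m(x q\<^sup>n\<^sup>/\<^sup>2)\<close>: the sign comes from the recurrence in \<open>m\<close>, the power of
  \<open>a q\<^sup>m\<close> from \<open>q\<^sup>n\<^sup>/\<^sup>2\<close> being raised to the opposite exponents \<open>\<nu> + m\<close> and
  \<open>-\<nu> - m\<close>.
\<close>

definition neg_factor :: "complex \<Rightarrow> int \<Rightarrow> int \<Rightarrow> complex" where
  "neg_factor a m n = (- 1) powi m * (a * Q powi m) powi (- n)"

definition sol_neg :: "complex \<Rightarrow> int \<Rightarrow> int \<Rightarrow> complex fls" where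
  "sol_neg a m n = cst (neg_factor a m n) * to_fls (dilate (Q powi n) (bessel2 (1 / (a * Q powi m))))"

lemma contiguous_sol_pos: "contiguous a (sol_pos a)"
  unfolding contiguous_def
proof (intro conjI allI)
  fix m n
  have "(1 + cst (Q powi n) * zvar) * sol_pos a m (n + 1) 
      = zvar powi m * to_fls ((1 + fps_const (Q powi n) * fps_X) * dilate (Q powi (n + 1)) (bessel2 (a * Q powi m)))"
    by (simp add: sol_pos_def cst_eq zvar_eq to_fls_mult mult_ac)
  also have "\<dots> = sol_pos a m n + cst (Q powi n) * sol_pos a (m + 1) n"
    unfolding bessel2_up_dilated
    by (simp add: sol_pos_def cst_eq to_fls_mult power_int_add mult_ac distrib_left zvar_eq)
  finally show "(1 + cst (Q powi n) * zvar) * sol_pos a m (n + 1) = sol_pos a m n + cst (Q powi n) * sol_pos a (m + 1) n" .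
  have "zvar powi m = zvar * zvar powi (m - 1)" by (simp add: power_int_diff)
  moreover have "sol_pos a m n = zvar powi m * to_fls (fps_const (a * Q powi m) * dilate (Q powi (n + 1)) (bessel2 (a * Q powi m)) + 
      dilate (Q powi (n + 1)) (bessel2 (a * Q powi m / Q)))"
    unfolding sol_pos_def bessel2_down_dilated[of n "a * Q powi m"] ..
  ultimately show "sol_pos a m n = cst (a * Q powi m) * sol_pos a m (n + 1) + zvar * sol_pos a (m - 1) (n + 1)"
    by (simp add: sol_pos_def cst_eq to_fls_mult power_int_diff mult_ac distrib_left del: fps_const_mult)
qed

lemma neg_factor_n: "a \<noteq> 0 \<Longrightarrow> neg_factor a m (n + 1) * (a * Q powi m) = neg_factor a m n"
  by (simp add: neg_factor_def power_int_diff power_int_minus power_int_add field_simps)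

lemma neg_factor_m: "a \<noteq> 0 \<Longrightarrow> Q powi n * neg_factor a (m + 1) n = - neg_factor a m n"
  by (simp add: neg_factor_def power_int_diff power_int_minus power_int_add power_int_mult_distrib field_simps)

lemma contiguous_sol_neg: 
  assumes a: "a \<noteq> 0"
  shows "contiguous a (sol_neg a)"
  unfolding contiguous_def
proof (intro conjI allI)
  fix m n
  define b where "b = a * Q powi m"
  have b: "b \<noteq> 0" using a by (simp add: b_def)
  have l1: "neg_factor a m (n + 1) = neg_factor a m n * (1 / b)"
    using neg_factor_n[OF a, of m n] b by (simp add: b_def field_simps)
  have "(1 + cst (Q powi n) * zvar) * sol_neg a m (n + 1) 
      = cst (neg_factor a m n) * to_fls (fps_const (1 / b) * ((1 + fps_const (Q powi n) * fps_X) * dilate (Q powi (n + 1)) (bessel2 (1 / b))))"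
    by (simp only: sol_neg_def cst_eq zvar_eq to_fls_mult l1 b_def[symmetric] fps_const_mult[symmetric]) 
       (simp add: mult_ac to_fls_mult del: fps_const_mult)
  also have "\<dots> = sol_neg a m n - cst (neg_factor a m n) * to_fls (dilate (Q powi n) (bessel2 (1 / b / Q)))"
    unfolding bessel2_up_inverse_dilated by (simp add: sol_neg_def right_diff_distrib flip: b_def)
  also have "neg_factor a m n = - (Q powi n * neg_factor a (m + 1) n)" using neg_factor_m[OF a] by simp
  hence "sol_neg a m n - cst (neg_factor a m n) * to_fls (dilate (Q powi n) (bessel2 (1 / b / Q))) = sol_neg a m n + cst (Q powi n) * sol_neg a (m + 1) n"
    by (simp add: sol_neg_def power_int_add cst_mult cst_minus b_def mult_ac)
  finally show "(1 + cst (Q powi n) * zvar) * sol_neg a m (n + 1) = sol_neg a m n + cst (Q powi n) * sol_neg a (m + 1) n" .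
  have l2: "neg_factor a (m - 1) (n + 1) = - (neg_factor a m n * (1 / b * Q powi (n + 1)))"
  proof -
    have "Q powi (n + 1) * neg_factor a m (n + 1) = - neg_factor a (m - 1) (n + 1)"
      using neg_factor_m[OF a, of "n + 1" "m - 1"] by simp
    thus ?thesis unfolding l1 by (simp add: mult_ac)
  qed
  have j: "1 / (a * Q powi (m - 1)) = 1 / b * Q" by (simp add: b_def power_int_diff)
  have "sol_neg a m n = cst (neg_factor a m n) * to_fls (dilate (Q powi (n + 1)) (bessel2 (1 / b))
     - fps_const (1 / b * Q powi (n + 1)) * fps_X * dilate (Q powi (n + 1)) (bessel2 (1 / b * Q)))"
    unfolding sol_neg_def b_def[symmetric] bessel2_down_inverse_dilated[of n "1 / b"] ..
  also have "\<dots> = cst (neg_factor a m n) * to_fls (dilate (Q powi (n + 1)) (bessel2 (1 / b)))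
     - cst (neg_factor a m n) * cst (1 / b * Q powi (n + 1)) * zvar * to_fls (dilate (Q powi (n + 1)) (bessel2 (1 / b * Q)))"
    by (simp add: right_diff_distrib to_fls_mult cst_eq zvar_eq mult.assoc del: fps_const_mult)
  also have "cst (neg_factor a m n) = cst b * cst (neg_factor a m (n + 1))"
    unfolding l1 using b by (simp flip: cst_mult)
  also have "cst b * cst (neg_factor a m (n + 1)) * cst (1 / b * Q powi (n + 1)) = - cst (neg_factor a (m - 1) (n + 1))"
    unfolding l1 l2 using b by (simp flip: cst_mult cst_minus)
  finally show "sol_neg a m n = cst (a * Q powi m) * sol_neg a m (n + 1) + zvar * sol_neg a (m - 1) (n + 1)"
    unfolding sol_neg_def j b_def[symmetric] by (simp add: algebra_simps)
qed

text \<open>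
  Up to the factor \<open>-z\<close>, the determinant of the two solutions at \<open>(0, 0)\<close> and \<open>(-1, 0)\<close>.
\<close>

definition wronski :: "complex \<Rightarrow> complex fps" where
  "wronski a = bessel2 (a / Q) * bessel2 (1 / a) + fps_X * bessel2 a * bessel2 (Q / a)"

lemma one_plus_X_nz: "(1 + fps_X :: complex fps) \<noteq> 0"
proof
  assume "(1 + fps_X :: complex fps) = 0"
  hence "fps_nth (1 + fps_X :: complex fps) 0 = fps_nth 0 0" by simp
  thus False by simp
qed

text \<open>
  The shift relations turn the determinant at \<open>q z\<close> into the one at \<open>z\<close>, which gives the
  functional equation of Euler's product.  Its constant factor vanishes exactly when \<open>a\<close> is an
  integral power of \<open>q\<close>, where the two solutions become dependent.
\<close>

lemma wronski_eq:
  assumes a: "a \<noteq> 0"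
  shows "wronski a = fps_const (qinf a * qinf (Q / a)) * euler"
proof -
  let ?s = "\<lambda>f. (1 + fps_X) * dilate Q f"
  define A B K L where "A = bessel2 a" and "B = bessel2 (a / Q)" and "K = bessel2 (1 / a)" and "L = bessel2 (Q / a)"
  note d = A_def B_def K_def L_def
  have 1: "?s B = B + fps_X * A" using bessel2_up[of "a / Q"] by (simp add: d)
  have 2: "?s K = K + fps_X * L" using bessel2_up[of "1 / a"] by (simp add: d)
  have 3: "fps_const a * ?s A = A - B" unfolding d by (rule bessel2_up_inverse)
  have 4: "fps_const (Q / a) * ?s L = L - K" using bessel2_up_inverse[of "Q / a"] a by (simp add: d)
  have q: "fps_const Q = fps_const a * fps_const (Q / a)" using a by simp
  have 5: "fps_const Q * (?s A * ?s L) = (A - B) * (L - K)"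
    unfolding 3[symmetric] 4[symmetric] q by (simp only: mult_ac)
  have "(1 + fps_X) * ?s (wronski a) = ?s B * ?s K + fps_X * (fps_const Q * (?s A * ?s L))"
    unfolding wronski_def d[symmetric] dilate_add dilate_mult dilate_X by (simp only: distrib_left mult_ac)
  also have "\<dots> = (1 + fps_X) * wronski a"
    unfolding 1 2 5 wronski_def d[symmetric] by (simp add: algebra_simps)
  finally have "?s (wronski a) = wronski a" using one_plus_X_nz by simp
  from euler_unique[OF this] show ?thesis by (simp add: wronski_def bessel2_def)
qed

lemma Cramer:
  fixes z1 z2 s t h1 h2 k1 k2 :: "'a::comm_ring_1"
  assumes "z1 = s * h1 + t * k1" "z2 = s * h2 + t * k2"
  shows "z1 * k2 - z2 * k1 = s * (h1 * k2 - h2 * k1)" "z1 * h2 - z2 * h1 = t * (k1 * h2 - k2 * h1)"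
  unfolding assms by (simp_all add: algebra_simps)

text \<open>
  The numerators of Cramer's rule for both \<open>S\<close> and \<open>T\<close>.  One definition suffices: replacing
  \<open>(m + 1, \<nu>)\<close> by \<open>(m, \<nu> + 1)\<close> turns the determinant with \<open>h(-1, 0)\<close> into that
  with \<open>h(0, 0)\<close>, which is why the same polynomials \<open>P\<^sup>(\<^sup>2\<^sup>)\<close> occur in both coefficients of
  the theorem.
\<close>

definition casorati :: "int \<Rightarrow> int \<Rightarrow> complex \<Rightarrow> complex fps" where
  "casorati M n a = fps_of_poly (Epoly n) *
     (fps_X ^ nat M * dilate (Q powi n) (bessel2 (a * Q powi (M - 1))) * bessel2 (Q / a)
      + fps_const (neg_factor a (M - 1) n) * fps_X ^ nat (- M) * dilate (Q powi n) (bessel2 (1 / (a * Q powi (M - 1)))) * bessel2 (a / Q))"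

lemma reduction_casorati:
  assumes R: "reduces_by m n S T" and a: "a \<noteq> 0"
  shows "fps_of_poly (S a) * wronski a = casorati (m + 1) n a"
    and "fps_of_poly (T a) * wronski a = casorati m n (a * Q)"
proof -
  define P where "P = zvar ^ nat (- m) * emb (Epoly n)"
  define F1 F2 where "F1 = dilate (Q powi n) (bessel2 (a * Q powi m))" and "F2 = dilate (Q powi n) (bessel2 (1 / (a * Q powi m)))"
  define W where "W = to_fls (wronski a)"
  have z: "P * h m n = (zvar ^ neg_ind m * emb (S a)) * h 0 0 + (zvar * emb (T a)) * h (- 1) 0" if "contiguous a h" for h
    using R that a by (simp add: reduces_by_def P_def)
  note cr = Cramer[OF z[OF contiguous_sol_pos] z[OF contiguous_sol_neg[OF a]]]
  have h: "sol_pos a 0 0 = to_fls (bessel2 a)" "zvar * sol_pos a (- 1) 0 = to_fls (bessel2 (a / Q))"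
      "sol_neg a 0 0 = to_fls (bessel2 (1 / a))" "sol_neg a (- 1) 0 = - to_fls (bessel2 (Q / a))"
      "sol_pos a m n = zvar powi m * to_fls F1" "sol_neg a m n = cst (neg_factor a m n) * to_fls F2"
    by (simp_all add: sol_pos_def sol_neg_def neg_factor_def power_int_minus divide_inverse F1_def F2_def cst_minus mult.commute[of Q])
  have om: "zvar * (sol_pos a (- 1) 0 * sol_neg a 0 0 - sol_neg a (- 1) 0 * sol_pos a 0 0) = W"
  proof -
    have "zvar * (sol_pos a (- 1) 0 * sol_neg a 0 0 - sol_neg a (- 1) 0 * sol_pos a 0 0)
        = (zvar * sol_pos a (- 1) 0) * to_fls (bessel2 (1 / a)) + zvar * to_fls (bessel2 a) * to_fls (bessel2 (Q / a))"
      unfolding h(1,3,4) by (simp add: algebra_simps)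
    thus ?thesis unfolding h(2) by (simp add: W_def wronski_def to_fls_mult zvar_eq)
  qed
  have "zvar ^ nat (- m) * zvar powi (m + 1) = zvar ^ neg_ind m * zvar ^ nat (m + 1)"
  proof (cases "m < 0")
    case True
    define k where "k = nat (- (m + 1))"
    have "nat (- m) = Suc k" "m + 1 = - int k" "nat (m + 1) = 0" using True by (auto simp: k_def)
    thus ?thesis using True by (simp only: power_int_minus power_int_of_nat) (simp add: neg_ind_def)
  qed (simp add: neg_ind_def power_int_def)
  moreover have "zvar powi (m + 1) = zvar * zvar powi m" by (simp add: power_int_add)
  \<comment> \<open>after cancelling \<open>zvar ^ neg_ind m\<close> the exponents are \<open>max (m + 1) 0\<close> and \<open>max (- m - 1) 0\<close>\<close>
  ultimately have p1: "zvar ^ nat (- m) * (zvar * zvar powi m) = zvar ^ neg_ind m * zvar ^ nat (m + 1)" by simp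
  have p2: "zvar ^ nat (- m) = zvar ^ neg_ind m * zvar ^ nat (- (m + 1))"
  proof -
    have "nat (- m) = neg_ind m + nat (- (m + 1))" by (auto simp: neg_ind_def)
    thus ?thesis by (simp only: power_add)
  qed
  have "zvar ^ neg_ind m * emb (S a) * W = - (zvar * (zvar ^ neg_ind m * emb (S a) * (sol_pos a 0 0 * sol_neg a (- 1) 0 - sol_neg a 0 0 * sol_pos a (- 1) 0)))"
    unfolding om[symmetric] by (simp add: algebra_simps)
  also have "\<dots> = - (zvar * (P * sol_pos a m n * sol_neg a (- 1) 0 - P * sol_neg a m n * sol_pos a (- 1) 0))"
    unfolding cr(1) ..
  also have "\<dots> = P * cst (neg_factor a m n) * to_fls F2 * (zvar * sol_pos a (- 1) 0) - P * zvar * zvar powi m * to_fls F1 * sol_neg a (- 1) 0"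
    unfolding h(5,6) by (simp add: algebra_simps)
  also have "\<dots> = emb (Epoly n) * (zvar ^ nat (- m) * (zvar * zvar powi m) * to_fls F1 * to_fls (bessel2 (Q / a)) + cst (neg_factor a m n) * zvar ^ nat (- m) * to_fls F2 * to_fls (bessel2 (a / Q)))"
    unfolding h(2,4) P_def by (simp add: algebra_simps)
  also have "\<dots> = zvar ^ neg_ind m * to_fls (casorati (m + 1) n a)"
    unfolding p1 by (subst p2) (simp add: casorati_def to_fls_mult fps_to_fls_power cst_eq zvar_eq emb_def F1_def F2_def distrib_left mult_ac)
  finally have "to_fls (fps_of_poly (S a) * wronski a) = to_fls (casorati (m + 1) n a)"
    by (simp add: mult.assoc to_fls_mult emb_def W_def)
  thus "fps_of_poly (S a) * wronski a = casorati (m + 1) n a" by simp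
  have l: "neg_factor (a * Q) (m - 1) n = - neg_factor a m n"
    using a by (simp add: neg_factor_def power_int_diff power_int_minus)
  have aq: "a * Q * Q powi (m - 1) = a * Q powi m" "Q / (a * Q) = 1 / a" "a * Q / Q = a"
    by (simp_all add: power_int_diff)
  have "emb (T a) * W = zvar * emb (T a) * (sol_pos a (- 1) 0 * sol_neg a 0 0 - sol_neg a (- 1) 0 * sol_pos a 0 0)"
    unfolding om[symmetric] by (simp add: mult_ac)
  also have "\<dots> = P * sol_pos a m n * sol_neg a 0 0 - P * sol_neg a m n * sol_pos a 0 0"
    unfolding cr(2) ..
  also have "\<dots> = emb (Epoly n) * ((zvar ^ nat (- m) * zvar powi m) * to_fls F1 * to_fls (bessel2 (1 / a)) - cst (neg_factor a m n) * zvar ^ nat (- m) * to_fls F2 * to_fls (bessel2 a))"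
    unfolding h P_def by (simp add: algebra_simps)
  also have "\<dots> = to_fls (casorati m n (a * Q))"
    unfolding zvar_clear casorati_def aq l
    by (simp add: to_fls_mult fps_to_fls_power cst_eq zvar_eq emb_def F1_def F2_def mult_ac flip: fps_const_neg)
  finally show "fps_of_poly (T a) * wronski a = casorati m n (a * Q)"
    by (simp add: emb_def W_def flip: to_fls_mult)
qed

text \<open>
  The product formula \<open>(-z; q)\<^sub>n (-z q\<^sup>n; q)\<^sub>\<infinity> = (-z; q)\<^sub>\<infinity>\<close>.
\<close>

lemma Epoly_euler: "n \<ge> 0 \<Longrightarrow> fps_of_poly (Epoly n) * dilate (Q powi n) euler = euler"
proof (induction n rule: int_ge_induct)
  case base show ?case by (simp add: Epoly_nonpos)
next
  case (step n)
  have "fps_of_poly [:1, Q powi n:] = 1 + fps_const (Q powi n) * fps_X"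
    by (simp add: fps_of_poly_pCons)
  moreover have "(1 + fps_const (Q powi n) * fps_X) * dilate (Q powi (n + 1)) euler = dilate (Q powi n) euler"
    using arg_cong[OF euler_dilate, of "dilate (Q powi n)"] by (simp add: dilate_mult dilate_add power_int_add)
  ultimately show ?case using step
    by (simp only: Epoly_Suc fps_of_poly_mult mult.assoc)
qed

text \<open>
  After division by \<open>(-z; q)\<^sub>\<infinity>\<close> one of the two second Bessel series becomes a first one.  For
  \<open>n \<ge> 0\<close> it is the dilated series, since the denominator \<open>(-z; q)\<^sub>n\<close> completes its factor
  \<open>(-z q\<^sup>n; q)\<^sub>\<infinity>\<close>; for \<open>n < 0\<close> it is the other one.
\<close>

definition mixed_prod :: "int \<Rightarrow> complex \<Rightarrow> complex \<Rightarrow> complex fps" where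
  "mixed_prod n u v = (if n \<ge> 0 then dilate (Q powi n) (bessel1 u) * bessel2 v else dilate (Q powi n) (bessel2 u) * bessel1 v)"

lemma mixed_prod_eq: "fps_of_poly (Epoly n) * (dilate (Q powi n) (bessel2 u) * bessel2 v) = euler * mixed_prod n u v"
proof (cases "n \<ge> 0")
  case True
  have "fps_of_poly (Epoly n) * (dilate (Q powi n) (bessel2 u) * bessel2 v) 
      = (fps_of_poly (Epoly n) * dilate (Q powi n) euler) * (dilate (Q powi n) (bessel1 u) * bessel2 v)"
    unfolding bessel2_eq_euler_bessel1[of u] by (simp add: dilate_mult)
  thus ?thesis using True by (simp add: Epoly_euler mixed_prod_def)
next
  case False
  thus ?thesis by (simp add: Epoly_nonpos mixed_prod_def bessel2_eq_euler_bessel1[of v])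
qed

definition mixed_casorati :: "int \<Rightarrow> int \<Rightarrow> complex \<Rightarrow> complex fps" where
  "mixed_casorati M n a = fps_X ^ nat M * mixed_prod n (a * Q powi (M - 1)) (Q / a)
      + fps_const (neg_factor a (M - 1) n) * fps_X ^ nat (- M) * mixed_prod n (1 / (a * Q powi (M - 1))) (a / Q)"

lemma casorati_eq: "casorati M n a = euler * mixed_casorati M n a"
proof -
  have "casorati M n a = fps_X ^ nat M * (fps_of_poly (Epoly n) * (dilate (Q powi n) (bessel2 (a * Q powi (M - 1))) * bessel2 (Q / a)))
     + fps_const (neg_factor a (M - 1) n) * fps_X ^ nat (- M) * (fps_of_poly (Epoly n) * (dilate (Q powi n) (bessel2 (1 / (a * Q powi (M - 1)))) * bessel2 (a / Q)))"
    by (simp add: casorati_def distrib_left mult_ac)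
  thus ?thesis unfolding mixed_prod_eq mixed_casorati_def by (simp add: distrib_left mult_ac)
qed

lemma reduction_mixed_casorati:
  assumes R: "reduces_by m n S T" and a: "a \<noteq> 0"
  shows "fps_const (qinf a * qinf (Q / a)) * fps_of_poly (S a) = mixed_casorati (m + 1) n a"
    and "fps_const (qinf a * qinf (Q / a)) * fps_of_poly (T a) = mixed_casorati m n (a * Q)"
proof -
  have "euler * (fps_const (qinf a * qinf (Q / a)) * fps_of_poly (S a)) = euler * mixed_casorati (m + 1) n a"
       "euler * (fps_const (qinf a * qinf (Q / a)) * fps_of_poly (T a)) = euler * mixed_casorati m n (a * Q)"
    using reduction_casorati[OF R a] unfolding wronski_eq[OF a] casorati_eq by (simp_all add: mult_ac del: fps_const_mult)
  thus "fps_const (qinf a * qinf (Q / a)) * fps_of_poly (S a) = mixed_casorati (m + 1) n a"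
    and "fps_const (qinf a * qinf (Q / a)) * fps_of_poly (T a) = mixed_casorati m n (a * Q)"
    by simp_all
qed

section \<open>Products of Bessel series as terminating hypergeometric series\<close>

lemma hypergeom_terminating:
  "basic_hypergeom [Q powi (- int i), B] [D] q x
   = (\<Sum>k=0..i. qpoch (Q powi (- int i)) q (int k) * qpoch B q (int k) / qpoch D q (int k) * inv_fact k * x ^ k)"
proof -
  have 0: "qpoch (Q powi (- int i)) q (int k) = 0" if "k > i" for k
    unfolding qpoch_nat using that by (auto simp: power_int_minus intro!: bexI[of _ i])
  show ?thesis unfolding basic_hypergeom_def
    by (subst suminf_finite[of "{0..i}"]) (auto simp: 0 inv_fact_def divide_inverse mult_ac)
qed

definition tri :: "nat \<Rightarrow> int" where "tri k = int k * (int k - 1) div 2"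

text \<open>
  Reversing the two shifted factorials of index \<open>i - k\<close> in a Cauchy product contributes two of these
  powers; they cancel the Gaussian factor \<open>q^(k\<^sup>2)\<close> of the second Bessel series up to \<open>q^k\<close>,
  so that no power \<open>q^(k choose 2)\<close> survives in the resulting series.
\<close>

lemma tri_twice: "Q powi (- tri k) * Q powi (- tri k) * Q ^ (k\<^sup>2) = Q ^ k"
proof -
  have "even (int k * (int k - 1))" by simp
  hence "2 * tri k = int k * (int k - 1)" unfolding tri_def by simp
  hence "- tri k + - tri k + int (k\<^sup>2) = int k" by (simp add: power2_eq_square algebra_simps)
  moreover have "Q powi (- tri k) * Q powi (- tri k) * Q ^ (k\<^sup>2) = Q powi (- tri k + - tri k + int (k\<^sup>2))"
    by (simp only: power_int_add[OF disjI1[OF Q_nz]] power_int_of_nat)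
  ultimately show ?thesis by (simp only: power_int_of_nat)
qed

lemma qinf_Q_nz: "qinf Q \<noteq> 0"
  using Q_power_Suc_neq_1 by (intro qinf_nz) simp

lemma inv_fact_qinf: "inv_fact k = qinf (Q ^ Suc k) / qinf Q"
  using qinf_split[of Q k] qinf_Q_nz qpoch_Q_nz[of k] by (simp add: inv_fact_def qpoch_nat field_simps)

lemma qinf_diff:
  assumes "k \<le> i" "u \<noteq> 0"
  shows "qinf (u * Q ^ Suc (i - k)) = qpoch (Q powi (- int i) / u) q (int k) * (- (u * Q ^ i)) ^ k
           * Q powi (- tri k) * qinf (u * Q ^ Suc i)"
proof -
  let ?c = "Q powi (- int i) / u"
  have "int (Suc (i - k)) = 1 - int k + int i" using assms by simp
  hence "Q ^ Suc (i - k) = Q powi (1 - int k + int i)" by (metis power_int_of_nat)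
  hence 1: "u * Q ^ Suc (i - k) = Q powi (1 - int k) / ?c"
    by (simp only: power_int_add[OF disjI1[OF Q_nz]]) (use assms in \<open>simp add: power_int_minus divide_simps\<close>)
  have 2: "- 1 / ?c = - (u * Q ^ i)" "Q / ?c = u * Q ^ Suc i"
    by (simp_all add: power_int_minus field_simps)
  show ?thesis unfolding 1 using qinf_reflect[of ?c k] assms(2) unfolding 2 tri_def by simp
qed

lemma inv_fact_diff:
  assumes "k \<le> i"
  shows "inv_fact (i - k) = qpoch (Q powi (- int i)) q (int k) * (- (Q ^ i)) ^ k * Q powi (- tri k) * inv_fact i"
  using qinf_diff[OF assms, of 1] by (simp add: inv_fact_qinf)

lemma qinf_div:
  assumes "qinf (v * Q) \<noteq> 0"
  shows "qinf (v * Q ^ Suc k) = qinf (v * Q) / qpoch (v * Q) q (int k)"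
  using qinf_split[of "v * Q" k] assms by (simp add: qpoch_nat mult_ac)

text \<open>
  The \<open>i\<close>-th coefficient of the Cauchy product, summed over the index of the second Bessel series;
  the factor of index \<open>i - k\<close> is reversed.  Summation over the other index yields
  \<open>mixed_prod_coeff_by_first\<close>, with a different argument.  The formulas for \<open>A\<close> and for \<open>B\<close>
  use one form each, and exchange them when \<open>n\<close> changes sign.
\<close>

lemma mixed_prod_coeff_by_second:
  assumes "u \<noteq> 0" "t \<noteq> 0" "qinf (v * Q) \<noteq> 0"
  shows "(dilate t (bessel1 u) * bessel2 v) $ i = (- 1) ^ i * t ^ i * qinf (v * Q) * qinf (u * Q ^ Suc i) * inv_fact i *
     basic_hypergeom [Q powi (- int i), Q powi (- int i) / u] [v * Q] q (u * v * Q ^ (2 * i + 1) / t)"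
proof -
  have "(dilate t (bessel1 u) * bessel2 v) $ i = (\<Sum>k=0..i. bessel2 v $ k * (t ^ (i - k) * bessel1 u $ (i - k)))"
    by (subst mult.commute) (simp add: fps_mult_nth)
  also have "\<dots> = (\<Sum>k=0..i. (- 1) ^ i * t ^ i * qinf (v * Q) * qinf (u * Q ^ Suc i) * inv_fact i *
     (qpoch (Q powi (- int i)) q (int k) * qpoch (Q powi (- int i) / u) q (int k) / qpoch (v * Q) q (int k) * inv_fact k 
        * (u * v * Q ^ (2 * i + 1) / t) ^ k))"
  proof (rule sum.cong[OF refl])
    fix k assume "k \<in> {0..i}"
    hence k: "k \<le> i" by simp
    have s: "(- 1 :: complex) ^ k * (- 1) ^ (i - k) = (- 1) ^ i" using k by (simp flip: power_add)
    have tt: "t ^ (i - k) = t ^ i / t ^ k" using k assms by (simp add: power_diff)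
    have "bessel2 v $ k * (t ^ (i - k) * bessel1 u $ (i - k)) = ((- 1) ^ k * (- 1) ^ (i - k)) * t ^ (i - k) *
       Q ^ (k\<^sup>2) * v ^ k * inv_fact k * qinf (v * Q ^ Suc k) * qinf (u * Q ^ Suc (i - k)) * inv_fact (i - k)"
      by (simp only: bessel1_def bessel2_def fps_nth_Abs_fps mult_ac)
    also have "\<dots> = (- 1) ^ i * (t ^ i / t ^ k) * v ^ k * inv_fact k * (qinf (v * Q) / qpoch (v * Q) q (int k)) *
        (qpoch (Q powi (- int i) / u) q (int k) * qinf (u * Q ^ Suc i)) * (qpoch (Q powi (- int i)) q (int k) * inv_fact i) *
        ((- (u * Q ^ i)) ^ k * (- (Q ^ i)) ^ k) * (Q powi (- tri k) * Q powi (- tri k) * Q ^ (k\<^sup>2))"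
      by (simp only: s tt qinf_div[OF assms(3)] inv_fact_diff[OF k] qinf_diff[OF k assms(1)] mult_ac)
    also have "(- (u * Q ^ i)) ^ k * (- (Q ^ i)) ^ k = (u * Q ^ (2 * i)) ^ k"
      by (simp only: mult_2 power_add flip: power_mult_distrib) (simp add: mult.assoc power_mult_distrib)
    also have "Q powi (- tri k) * Q powi (- tri k) * Q ^ (k\<^sup>2) = Q ^ k" by (rule tri_twice)
    finally show "bessel2 v $ k * (t ^ (i - k) * bessel1 u $ (i - k)) = (- 1) ^ i * t ^ i * qinf (v * Q) * qinf (u * Q ^ Suc i) * inv_fact i *
     (qpoch (Q powi (- int i)) q (int k) * qpoch (Q powi (- int i) / u) q (int k) / qpoch (v * Q) q (int k) * inv_fact k 
        * (u * v * Q ^ (2 * i + 1) / t) ^ k)"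
      by (simp add: power_mult_distrib power_divide mult_ac)
  qed
  finally show ?thesis unfolding hypergeom_terminating by (simp only: sum_distrib_left)
qed

lemma mixed_prod_coeff_by_first:
  assumes "v \<noteq> 0" "qinf (u * Q) \<noteq> 0"
  shows "(dilate t (bessel1 u) * bessel2 v) $ i = (- 1) ^ i * Q ^ (i\<^sup>2) * v ^ i * qinf (u * Q) * qinf (v * Q ^ Suc i) * inv_fact i *
     basic_hypergeom [Q powi (- int i), Q powi (- int i) / v] [u * Q] q (t * Q)"
proof -
  have "(dilate t (bessel1 u) * bessel2 v) $ i = (\<Sum>k=0..i. (t ^ k * bessel1 u $ k) * bessel2 v $ (i - k))"
    by (simp add: fps_mult_nth)
  also have "\<dots> = (\<Sum>k=0..i. (- 1) ^ i * Q ^ (i\<^sup>2) * v ^ i * qinf (u * Q) * qinf (v * Q ^ Suc i) * inv_fact i *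
     (qpoch (Q powi (- int i)) q (int k) * qpoch (Q powi (- int i) / v) q (int k) / qpoch (u * Q) q (int k) * inv_fact k 
        * (t * Q) ^ k))"
  proof (rule sum.cong[OF refl])
    fix k assume "k \<in> {0..i}"
    hence k: "k \<le> i" by simp
    have s: "(- 1 :: complex) ^ k * (- 1) ^ (i - k) = (- 1) ^ i" using k by (simp flip: power_add)
    have tt: "v ^ (i - k) = v ^ i / v ^ k" using k assms by (simp add: power_diff)
    have "(i - k)\<^sup>2 + 2 * i * k = i\<^sup>2 + k\<^sup>2"
      using k by (auto simp: le_iff_add power2_eq_square algebra_simps)
    hence "Q ^ ((i - k)\<^sup>2) * Q ^ (2 * i * k) = Q ^ (i\<^sup>2) * Q ^ (k\<^sup>2)" by (metis power_add)
    hence qq: "Q ^ ((i - k)\<^sup>2) = Q ^ (i\<^sup>2) * Q ^ (k\<^sup>2) / Q ^ (2 * i * k)" by (simp add: field_simps)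
    have "(t ^ k * bessel1 u $ k) * bessel2 v $ (i - k) = ((- 1) ^ k * (- 1) ^ (i - k)) * t ^ k *
       Q ^ ((i - k)\<^sup>2) * v ^ (i - k) * inv_fact k * qinf (u * Q ^ Suc k) * qinf (v * Q ^ Suc (i - k)) * inv_fact (i - k)"
      by (simp only: bessel1_def bessel2_def fps_nth_Abs_fps mult_ac)
    also have "\<dots> = (- 1) ^ i * t ^ k * Q ^ (i\<^sup>2) * v ^ i * inv_fact k * (qinf (u * Q) / qpoch (u * Q) q (int k)) *
        (qpoch (Q powi (- int i) / v) q (int k) * qinf (v * Q ^ Suc i)) * (qpoch (Q powi (- int i)) q (int k) * inv_fact i) *
        (((- (v * Q ^ i)) ^ k * (- (Q ^ i)) ^ k) / (v ^ k * Q ^ (2 * i * k))) * (Q powi (- tri k) * Q powi (- tri k) * Q ^ (k\<^sup>2))"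
      unfolding s tt qq qinf_div[OF assms(2)] inv_fact_diff[OF k] qinf_diff[OF k assms(1)]
      by (simp only: divide_inverse mult_ac inverse_mult_distrib)
    also have "(- (v * Q ^ i)) ^ k * (- (Q ^ i)) ^ k = v ^ k * Q ^ (2 * i * k)"
      by (simp only: mult_2 power_add power_mult[of Q "i + i"] flip: power_mult_distrib) (simp add: mult.assoc power_mult_distrib)
    also have "v ^ k * Q ^ (2 * i * k) / (v ^ k * Q ^ (2 * i * k)) = 1" using assms by simp
    also have "Q powi (- tri k) * Q powi (- tri k) * Q ^ (k\<^sup>2) = Q ^ k" by (rule tri_twice)
    finally show "(t ^ k * bessel1 u $ k) * bessel2 v $ (i - k) = (- 1) ^ i * Q ^ (i\<^sup>2) * v ^ i * qinf (u * Q) * qinf (v * Q ^ Suc i) * inv_fact i *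
     (qpoch (Q powi (- int i)) q (int k) * qpoch (Q powi (- int i) / v) q (int k) / qpoch (u * Q) q (int k) * inv_fact k 
        * (t * Q) ^ k)"
      by (simp add: power_mult_distrib power_divide mult_ac)
  qed
  finally show ?thesis unfolding hypergeom_terminating by (simp only: sum_distrib_left)
qed

lemma mixed_prod_swap:
  assumes "t \<noteq> 0"
  shows "(dilate t (bessel2 u) * bessel1 v) $ i = t ^ i * (dilate (1 / t) (bessel1 v) * bessel2 u) $ i"
proof -
  have "dilate t (bessel2 u) * bessel1 v = dilate t (dilate (1 / t) (bessel1 v) * bessel2 u)"
    using assms by (simp add: dilate_mult mult.commute)
  thus ?thesis by simp
qed

section \<open>The coefficients for generic order\<close>

lemma qpow_exp: "qpow q s = exp (s * of_real (ln q))"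
  using q_pos by (simp add: qpow_def powr_def Ln_of_real)

lemma qpow_nz [simp]: "qpow q s \<noteq> 0" by (simp add: qpow_exp)

lemma qpow_add: "qpow q (s + t) = qpow q s * qpow q t"
  by (simp add: qpow_exp exp_add algebra_simps)

lemma qpow_diff: "qpow q (s - t) = qpow q s / qpow q t"
  by (simp add: qpow_exp exp_diff algebra_simps)

lemma qpow_minus: "qpow q (- t) = inverse (qpow q t)"
  by (simp add: qpow_exp exp_minus)

lemma qpow_of_int_mult: "qpow q (of_int k * s) = qpow q s powi k"
  by (simp add: qpow_exp exp_power_int mult.assoc)

lemma qpow_1: "qpow q 1 = Q"
  using q_pos by (simp add: qpow_exp exp_of_real)

lemma qpow_of_int: "qpow q (of_int k) = Q powi k"
  using qpow_of_int_mult[of k 1] by (simp add: qpow_1)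

lemma qpow_of_nat: "qpow q (of_nat k) = Q ^ k"
  using qpow_of_int[of "int k"] by simp

lemma qpow_2: "qpow q (2 - s) = Q\<^sup>2 / qpow q s"
  using qpow_of_nat[of 2] by (simp add: qpow_diff)

lemma qpow_tendsto: "(f \<longlongrightarrow> s) G \<Longrightarrow> ((\<lambda>t. qpow q (f t)) \<longlongrightarrow> qpow q s) G"
  unfolding qpow_exp by (intro tendsto_intros)

definition A_coeff :: "int \<Rightarrow> int \<Rightarrow> complex \<Rightarrow> int \<Rightarrow> complex" where
  "A_coeff M n \<nu> j = (if 0 \<le> n then A2 M n \<nu> j q else A2' M n \<nu> j q)"

definition B_coeff :: "int \<Rightarrow> int \<Rightarrow> complex \<Rightarrow> int \<Rightarrow> complex" where
  "B_coeff M n \<nu> j = (if 0 \<le> n then B2 M n \<nu> j q else B2' M n \<nu> j q)"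

lemma qpoch_Q_neg: "l < 0 \<Longrightarrow> qpoch Q q l = 0"
proof -
  assume l: "l < 0"
  have "Q * Q powi l * Q ^ nat (- l - 1) = Q powi (1 + l + int (nat (- l - 1)))"
    by (simp only: power_int_add[OF disjI1[OF Q_nz]] power_int_of_nat power_int_1_right)
  also have "1 + l + int (nat (- l - 1)) = 0" using l by simp
  finally have "(\<Prod>i<nat (- l). 1 - Q * Q powi l * Q ^ i) = 0"
    using l by (auto intro!: bexI[of _ "nat (- l - 1)"])
  thus ?thesis using l by (simp add: qpoch_def)
qed

lemma A_coeff_neg: "j < 0 \<Longrightarrow> A_coeff M n \<nu> j = 0" and B_coeff_neg: "j < 0 \<Longrightarrow> B_coeff M n \<nu> j = 0"
  by (simp_all add: A_coeff_def B_coeff_def A2_def A2'_def B2_def B2'_def qpoch_Q_neg)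

text \<open>
  The parameters for which the two solutions are independent and \<open>(a; q)\<^sub>k\<close> is finite and nonzero for
  every integer \<open>k\<close>.
\<close>

definition generic :: "complex \<Rightarrow> bool" where "generic a \<longleftrightarrow> a \<noteq> 0 \<and> (\<forall>k::int. a * Q powi k \<noteq> 1)"

lemma generic_shift: "generic a \<Longrightarrow> generic (a * Q powi k)"
  by (auto simp: generic_def mult.assoc simp flip: power_int_add)

lemma generic_inverse: "generic a \<Longrightarrow> generic (1 / a)"
  unfolding generic_def
proof safe
  fix k assume a: "\<forall>k. a * Q powi k \<noteq> 1" "a \<noteq> 0" "1 / a * Q powi k = 1"
  hence "a * Q powi (- k) = 1" by (simp add: power_int_minus field_simps)
  thus False using a by blast
qed auto

lemma generic_mult: "generic a \<Longrightarrow> generic (a * Q)" "generic a \<Longrightarrow> generic (Q / a)" "generic a \<Longrightarrow> generic (Q\<^sup>2 / a)"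
  using generic_shift[of a 1] generic_shift[of "1 / a" 1] generic_shift[of "1 / a" 2] generic_inverse[of a] by simp_all

lemma generic_qinf: "generic a \<Longrightarrow> qinf a \<noteq> 0"
  by (rule qinf_nz) (metis generic_def power_int_of_nat)

lemma generic_qpoch:
  assumes "generic a"
  shows "qpoch a q k \<noteq> 0" "qinf a = qpoch a q k * qinf (a * Q powi k)"
proof -
  have "1 - a * Q powi k * Q ^ i \<noteq> 0" for i
    using generic_shift[OF assms, of k] by (metis generic_def power_int_of_nat eq_iff_diff_eq_0)
  hence "(\<Prod>i<nat (- k). 1 - (a * Q powi k) * Q ^ i) \<noteq> 0" by simp
  from qpoch_mult_qinf[of k a, OF this] show 1: "qinf a = qpoch a q k * qinf (a * Q powi k)" by simp
  show "qpoch a q k \<noteq> 0" using 1 generic_qinf[OF assms] by auto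
qed

lemma Q_powi_mult_nat: "(Q powi n) ^ i = Q powi (n * int i)"
  by (simp add: power_int_mult)

text \<open>
  In this lemma and the next, all shifted factorials are replaced by quotients of infinite products;
  \<open>X\<close> is the product left over after the cancellation, and what remains to be compared are signs and
  powers of \<open>a\<close> and \<open>q\<close>.
\<close>

lemma B_coeff_generic:
  assumes g: "generic (qpow q \<nu>)" and a: "a = qpow q \<nu>"
  shows "mixed_prod n (a * Q powi (M - 1)) (Q / a) $ i * (qpoch a q M * (1 - Q / a))
         = (- a) ^ i * B_coeff M n \<nu> (int i) * (qinf a * qinf (Q / a))"
proof -
  define D X p where "D = qpoch (Q\<^sup>2 / a) q (int i)" and "X = qinf (Q\<^sup>2 / a * Q ^ i)" and "p = qpoch a q M"
  have ga: "generic a" using g a by simp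
  have anz: "a \<noteq> 0" using a by simp
  have D: "D \<noteq> 0" unfolding D_def by (intro generic_qpoch generic_mult ga)
  have q1: "qinf (Q / a) = (1 - Q / a) * (D * X)"
    using qinf_step[of "Q / a"] generic_qpoch(2)[OF generic_mult(3)[OF ga], of "int i"]
    by (simp add: D_def X_def power2_eq_square)
  have q2: "qinf a = p * qinf (a * Q powi M)" unfolding p_def by (rule generic_qpoch) fact
  define u v where "u = a * Q powi (M - 1)" and "v = Q / a"
  have uv: "u \<noteq> 0" "v \<noteq> 0" "Q powi n \<noteq> 0" "1 / Q powi n \<noteq> 0" using anz by (simp_all add: u_def v_def)
  have uQ: "u * Q = a * Q powi M" by (simp add: u_def power_int_diff)
  have vQ: "v * Q ^ Suc i = Q\<^sup>2 / a * Q ^ i" by (simp add: v_def power2_eq_square)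
  have gu: "qinf (u * Q) \<noteq> 0" unfolding uQ by (intro generic_qinf generic_shift ga)
  have vd: "Q powi (- int i) / v = qpow q (\<nu> - of_int (int i + 1))"
    unfolding v_def by (simp only: qpow_diff qpow_of_int a[symmetric])
       (simp add: power_int_add power_int_minus field_simps)
  have uq: "u * Q = qpow q (\<nu> + of_int M)" unfolding uQ by (simp only: qpow_add qpow_of_int a)
  have qm: "qpow q (of_int (- int i)) = Q powi (- int i)" by (rule qpow_of_int)
  show ?thesis
  proof (cases "n \<ge> 0")
    case True
    define \<phi> where "\<phi> = basic_hypergeom [Q powi (- int i), Q powi (- int i) / v] [u * Q] q (Q powi n * Q)"
    have arg: "Q powi n * Q = qpow q (of_int (n + 1))" by (simp only: qpow_of_int) (simp add: power_int_add)
    have P: "mixed_prod n u v $ i = (- 1) ^ i * Q ^ (i\<^sup>2) * v ^ i * qinf (u * Q) * X * inv_fact i * \<phi>"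
      using True mixed_prod_coeff_by_first[OF uv(2) gu, of "Q powi n" i] by (simp only: mixed_prod_def \<phi>_def X_def vQ[symmetric] if_True)
    have hyp: "basic_hypergeom [qpow q (of_int (- int i)), qpow q (\<nu> - of_int (int i + 1))] [qpow q (\<nu> + of_int M)] q (qpow q (of_int (n + 1))) = \<phi>"
      unfolding \<phi>_def vd uq arg qm ..
    have B: "B_coeff M n \<nu> (int i) = inv_fact i / D * (Q powi (int i * (int i + 1)) * inverse (a powi (2 * int i))) * \<phi>"
      using True unfolding B_coeff_def B2_def hyp 
      by (simp only: qpow_diff[of "of_int (int i * (int i + 1))"] qpow_of_int_mult qpow_of_int qpow_2 a[symmetric] D_def[symmetric] if_True)
         (simp add: inv_fact_def divide_inverse mult_ac)
    have e: "(- 1) ^ i * Q ^ (i\<^sup>2) * v ^ i = (- a) ^ i * (Q powi (int i * (int i + 1)) * inverse (a powi (2 * int i)))"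
    proof -
      have "int i * (int i + 1) = int (i\<^sup>2 + i)" "2 * int i = int (i + i)" by (simp_all add: power2_eq_square algebra_simps)
      hence "Q powi (int i * (int i + 1)) = Q ^ (i\<^sup>2) * Q ^ i" "a powi (2 * int i) = a ^ i * a ^ i"
        by (simp_all only: power_int_of_nat power_add)
      thus ?thesis using anz by (simp add: v_def power_divide power_minus[of a] field_simps)
    qed
    show ?thesis unfolding u_def[symmetric] v_def[symmetric] p_def[symmetric] P B q1[folded v_def] q2 e
      using D by (simp add: uQ)
  next
    case False
    define \<phi> where "\<phi> = basic_hypergeom [Q powi (- int i), Q powi (- int i) / v] [u * Q] q (v * u * Q ^ (2 * i + 1) / (1 / Q powi n))"
    have arg: "v * u * Q ^ (2 * i + 1) / (1 / Q powi n) = qpow q (of_int (2 * int i + M + n + 1))" 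
    proof -
      have "v * u = Q powi M" using anz by (simp add: u_def v_def power_int_diff)
      moreover have "Q ^ (2 * i + 1) = Q powi (2 * int i + 1)" by (subst power_int_of_nat[symmetric]) (simp add: add.commute)
      moreover have "2 * int i + M + n + 1 = M + (2 * int i + 1) + n" by simp
      ultimately show ?thesis by (simp only: qpow_of_int power_int_add[OF disjI1[OF Q_nz]]) simp
    qed
    have tt: "(Q powi n) ^ i * (1 / Q powi n) ^ i = 1" by (simp add: power_one_over)
    have "mixed_prod n u v $ i = (Q powi n) ^ i * ((- 1) ^ i * (1 / Q powi n) ^ i * qinf (u * Q) * X * inv_fact i * \<phi>)"
      using False mixed_prod_swap[OF uv(3), of u v i] mixed_prod_coeff_by_second[OF uv(2,4) gu, of i] 
      by (simp only: mixed_prod_def \<phi>_def X_def vQ[symmetric] if_False)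
    also have "\<dots> = ((Q powi n) ^ i * (1 / Q powi n) ^ i) * ((- 1) ^ i * qinf (u * Q) * X * inv_fact i * \<phi>)"
      by (simp only: mult_ac)
    finally have P: "mixed_prod n u v $ i = (- 1) ^ i * qinf (u * Q) * X * inv_fact i * \<phi>"
      unfolding tt by simp
    have hyp: "basic_hypergeom [qpow q (of_int (- int i)), qpow q (\<nu> - of_int (int i + 1))] [qpow q (\<nu> + of_int M)] q (qpow q (of_int (2 * int i + M + n + 1))) = \<phi>"
      unfolding \<phi>_def vd uq arg qm ..
    have B: "B_coeff M n \<nu> (int i) = inv_fact i / D * (a powi (- int i)) * \<phi>"
      using False unfolding B_coeff_def B2'_def hyp 
      by (simp only: of_int_minus[symmetric] qpow_of_int_mult qpow_of_int qpow_2 a[symmetric] D_def[symmetric] if_False)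
         (simp add: inv_fact_def divide_inverse mult_ac)
    have e: "(- 1) ^ i = (- a) ^ i * (a powi (- int i))"
      using anz by (simp add: power_minus[of a] power_int_minus)
    show ?thesis unfolding u_def[symmetric] v_def[symmetric] p_def[symmetric] P B q1[folded v_def] q2 e
      using D by (simp add: uQ)
  qed
qed

lemma A_coeff_generic:
  assumes g: "generic (qpow q \<nu>)" and a: "a = qpow q \<nu>"
  shows "neg_factor a (M - 1) n * mixed_prod n (1 / (a * Q powi (M - 1))) (a / Q) $ i * (qpoch a q M * (1 - Q / a))
         = - ((- a) powi (int i - M) * A_coeff M n \<nu> (int i) * (qinf a * qinf (Q / a)))"
proof -
  define D X p where "D = qpoch (Q\<^sup>2 / a) q (int i - M)" and "X = qinf (Q\<^sup>2 / a * Q powi (int i - M))" and "p = qpoch a q M"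
  have ga: "generic a" using g a by simp
  have anz: "a \<noteq> 0" using a by simp
  have D: "D \<noteq> 0" unfolding D_def by (intro generic_qpoch generic_mult ga)
  have q1: "qinf (Q / a) = (1 - Q / a) * (D * X)"
    using qinf_step[of "Q / a"] generic_qpoch(2)[OF generic_mult(3)[OF ga], of "int i - M"]
    by (simp add: D_def X_def power2_eq_square)
  define w where "w = 1 - Q / a"
  define u v where "u = 1 / (a * Q powi (M - 1))" and "v = a / Q"
  have uv: "u \<noteq> 0" "v \<noteq> 0" "Q powi n \<noteq> 0" "1 / Q powi n \<noteq> 0" using anz by (simp_all add: u_def v_def)
  have vQ: "v * Q = a" by (simp add: v_def)
  have "u = inverse a * (Q * Q powi (- M))"
    using anz by (simp add: u_def power_int_diff power_int_minus divide_simps)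
  hence uQ: "u * Q ^ Suc i = Q\<^sup>2 / a * Q powi (int i - M)"
    by (simp add: power2_eq_square power_int_diff power_int_minus divide_inverse mult_ac)
  have gv: "qinf (v * Q) \<noteq> 0" unfolding vQ by (intro generic_qinf ga)
  have ud: "Q powi (- int i) / u = qpow q (\<nu> + of_int (M - int i - 1))"
  proof -
    have "Q powi (M - int i - 1) = Q powi (- int i) * Q powi (M - 1)"
      by (simp only: power_int_add[OF disjI1[OF Q_nz], symmetric]) (simp add: algebra_simps)
    thus ?thesis unfolding u_def by (simp only: qpow_add qpow_of_int a[symmetric]) (simp add: mult_ac)
  qed
  have vq: "v * Q = qpow q \<nu>" unfolding vQ by (rule a)
  have qm: "qpow q (of_int (- int i)) = Q powi (- int i)" by (rule qpow_of_int)
  have sgn: "(- 1) powi (M - 1) * (- 1) ^ i = - ((- 1 :: complex) powi (int i - M))"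
    by (simp add: power_int_diff power_int_minus_one_minus field_simps power_int_minus_one_mult_self')
  have neg: "(- a) powi k = (- 1) powi k * a powi k" for k
    using power_int_mult_distrib[of "-1" a k] by simp
  have lm: "neg_factor a (M - 1) n = (- 1) powi (M - 1) * (a powi (- n) * Q powi (- ((M - 1) * n)))"
    unfolding neg_factor_def by (simp add: power_int_mult_distrib power_int_mult power_int_minus)
  show ?thesis
  proof (cases "n \<ge> 0")
    case True
    define \<phi> where "\<phi> = basic_hypergeom [Q powi (- int i), Q powi (- int i) / u] [v * Q] q (u * v * Q ^ (2 * i + 1) / Q powi n)"
    have arg: "u * v * Q ^ (2 * i + 1) / Q powi n = qpow q (of_int (2 * int i - M - n + 1))"
    proof -
      have "u * v = Q powi (- M)" using anz by (simp add: u_def v_def power_int_diff power_int_minus field_simps)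
      moreover have "Q ^ (2 * i + 1) = Q powi (2 * int i + 1)" by (subst power_int_of_nat[symmetric]) (simp add: add.commute)
      moreover have "2 * int i - M - n + 1 = - M + (2 * int i + 1) - n" by simp
      ultimately show ?thesis by (simp only: qpow_of_int power_int_add[OF disjI1[OF Q_nz]] power_int_diff[OF disjI1[OF Q_nz]])
    qed
    have P: "mixed_prod n u v $ i = (- 1) ^ i * (Q powi n) ^ i * qinf a * X * inv_fact i * \<phi>"
      using True mixed_prod_coeff_by_second[OF uv(1,3) gv, of i] by (simp only: mixed_prod_def \<phi>_def X_def uQ[symmetric] vQ if_True)
    have hyp: "basic_hypergeom [qpow q (of_int (- int i)), qpow q (\<nu> + of_int (M - int i - 1))] [qpow q \<nu>] q (qpow q (of_int (2 * int i - M - n + 1))) = \<phi>"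
      unfolding \<phi>_def ud vq arg qm ..
    have A: "A_coeff M n \<nu> (int i) = p * inv_fact i / D * (Q powi ((int i - M + 1) * n) / (a powi (int i - M + n))) * \<phi>"
      using True unfolding A_coeff_def A2_def hyp
      by (simp only: qpow_diff[of "of_int ((int i - M + 1) * n)"] of_int_diff[symmetric] of_int_add[symmetric] qpow_of_int_mult qpow_of_int qpow_2 a[symmetric] D_def[symmetric] p_def[symmetric] if_True)
         (simp add: inv_fact_def divide_inverse mult_ac)
    have "Q powi (- ((M - 1) * n)) * (Q powi n) ^ i = Q powi ((int i - M + 1) * n)"
      unfolding Q_powi_mult_nat by (simp only: power_int_add[OF disjI1[OF Q_nz], symmetric]) (simp add: algebra_simps)
    moreover have "a powi (- n) = a powi (int i - M) / a powi (int i - M + n)"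
      using anz by (simp only: power_int_diff[OF disjI1[OF anz], symmetric]) simp
    ultimately have "(- 1) powi (M - 1) * (- 1) ^ i * a powi (- n) * (Q powi (- ((M - 1) * n)) * (Q powi n) ^ i)
        = - ((- a) powi (int i - M) * (Q powi ((int i - M + 1) * n) / (a powi (int i - M + n))))"
      unfolding neg sgn by simp
    hence e: "neg_factor a (M - 1) n * ((- 1) ^ i * (Q powi n) ^ i)
        = - ((- a) powi (int i - M) * (Q powi ((int i - M + 1) * n) / (a powi (int i - M + n))))"
      unfolding lm by (simp only: mult_ac)
    have "neg_factor a (M - 1) n * mixed_prod n u v $ i = neg_factor a (M - 1) n * ((- 1) ^ i * (Q powi n) ^ i) * (qinf a * X * inv_fact i * \<phi>)"
      unfolding P by (simp only: mult_ac)
    thus ?thesis unfolding e u_def[symmetric] v_def[symmetric] p_def[symmetric] A q1 w_def[symmetric]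
      using D by (simp add: mult_ac)
  next
    case False
    define \<phi> where "\<phi> = basic_hypergeom [Q powi (- int i), Q powi (- int i) / u] [v * Q] q (1 / Q powi n * Q)"
    have arg: "1 / Q powi n * Q = qpow q (of_int (1 - n))"
      by (simp only: qpow_of_int power_int_diff[OF disjI1[OF Q_nz]]) simp
    have P: "mixed_prod n u v $ i = (Q powi n) ^ i * ((- 1) ^ i * Q ^ (i\<^sup>2) * u ^ i * qinf a * X * inv_fact i * \<phi>)"
      using False mixed_prod_swap[OF uv(3), of u v i] mixed_prod_coeff_by_first[OF uv(1) gv, of "1 / Q powi n" i]
      by (simp only: mixed_prod_def \<phi>_def X_def uQ[symmetric] vQ if_False)
    have hyp: "basic_hypergeom [qpow q (of_int (- int i)), qpow q (\<nu> + of_int (M - int i - 1))] [qpow q \<nu>] q (qpow q (of_int (1 - n))) = \<phi>"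
      unfolding \<phi>_def ud vq arg qm ..
    have A: "A_coeff M n \<nu> (int i) = p * inv_fact i / D * (Q powi ((int i - M + 1) * (int i + n)) / (a powi (2 * int i - M + n))) * \<phi>"
      using False unfolding A_coeff_def A2'_def hyp
      by (simp only: qpow_diff[of "of_int ((int i - M + 1) * (int i + n))"] of_int_diff[symmetric] of_int_add[symmetric] qpow_of_int_mult qpow_of_int qpow_2 a[symmetric] D_def[symmetric] p_def[symmetric] if_False)
         (simp add: inv_fact_def divide_inverse mult_ac)
    have ui: "u ^ i = a powi (- int i) * Q powi (- ((M - 1) * int i))"
      unfolding u_def by (simp add: power_divide power_mult_distrib power_int_mult power_int_minus divide_inverse power_inverse)
    have "Q powi (- ((M - 1) * n)) * (Q powi n) ^ i * Q ^ (i\<^sup>2) * Q powi (- ((M - 1) * int i)) = Q powi ((int i - M + 1) * (int i + n))"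
      unfolding Q_powi_mult_nat by (simp only: power_int_add[OF disjI1[OF Q_nz], symmetric] power_int_of_nat[symmetric]) (simp add: algebra_simps power2_eq_square)
    moreover have "a powi (- n) * a powi (- int i) = a powi (int i - M) / a powi (2 * int i - M + n)"
      using anz by (simp only: power_int_diff[OF disjI1[OF anz], symmetric] power_int_add[OF disjI1[OF anz], symmetric]) (simp add: algebra_simps)
    ultimately have "(- 1) powi (M - 1) * (- 1) ^ i * (a powi (- n) * a powi (- int i)) * 
        (Q powi (- ((M - 1) * n)) * (Q powi n) ^ i * Q ^ (i\<^sup>2) * Q powi (- ((M - 1) * int i)))
        = - ((- a) powi (int i - M) * (Q powi ((int i - M + 1) * (int i + n)) / (a powi (2 * int i - M + n))))"
      unfolding neg sgn by simp
    hence e: "neg_factor a (M - 1) n * ((Q powi n) ^ i * ((- 1) ^ i * Q ^ (i\<^sup>2) * u ^ i))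
        = - ((- a) powi (int i - M) * (Q powi ((int i - M + 1) * (int i + n)) / (a powi (2 * int i - M + n))))"
      unfolding lm ui by (simp only: mult_ac)
    have "neg_factor a (M - 1) n * mixed_prod n u v $ i = neg_factor a (M - 1) n * ((Q powi n) ^ i * ((- 1) ^ i * Q ^ (i\<^sup>2) * u ^ i)) * (qinf a * X * inv_fact i * \<phi>)"
      unfolding P by (simp only: mult_ac)
    thus ?thesis unfolding e u_def[symmetric] v_def[symmetric] p_def[symmetric] A q1 w_def[symmetric]
      using D by (simp add: mult_ac)
  qed
qed

text \<open>
  The two terms of the determinant start at the powers \<open>max M 0\<close> and \<open>- min M 0\<close> of \<open>z\<close>.
  Below them the shifted indices of \<open>A\<close> and \<open>B\<close> are negative and the
  corresponding terms on both sides vanish.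
\<close>

lemma mixed_casorati_coeff:
  assumes g: "generic (qpow q \<nu>)" and a: "a = qpow q \<nu>"
  shows "mixed_casorati M n a $ j * (qpoch a q M * (1 - Q / a))
     = - ((- 1 / a) ^ nat M * (- a) ^ j * (A_coeff M n \<nu> (int j + min M 0) - B_coeff M n \<nu> (int j - max M 0))) * (qinf a * qinf (Q / a))"
proof -
  have anz: "a \<noteq> 0" using a by simp
  have pw: "(- 1 / a) ^ nat M * (- a) ^ j = (- a) powi (int j - int (nat M))"
  proof -
    have "- 1 / a = inverse (- a)" "- a \<noteq> 0" using anz by (simp_all add: divide_inverse)
    thus ?thesis by (simp only: power_inverse power_int_diff simp_thms power_int_of_nat divide_inverse mult.commute)
  qed
  have 1: "(fps_X ^ nat M * mixed_prod n (a * Q powi (M - 1)) (Q / a)) $ j * (qpoch a q M * (1 - Q / a))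
     = ((- 1 / a) ^ nat M * (- a) ^ j * B_coeff M n \<nu> (int j - max M 0)) * (qinf a * qinf (Q / a))"
  proof (cases "j < nat M")
    case True
    hence "int j - max M 0 < 0" by auto
    thus ?thesis using True by (simp add: fps_X_power_mult_nth B_coeff_neg)
  next
    case False
    hence e: "int j - max M 0 = int (j - nat M)" "int j - int (nat M) = int (j - nat M)" by auto
    show ?thesis using False B_coeff_generic[OF g a, of n M "j - nat M"]
      unfolding pw e by (simp only: fps_X_power_mult_nth if_False power_int_of_nat)
  qed
  have 2: "(fps_X ^ nat (- M) * mixed_prod n (1 / (a * Q powi (M - 1))) (a / Q)) $ j * neg_factor a (M - 1) n * (qpoch a q M * (1 - Q / a))
     = - ((- 1 / a) ^ nat M * (- a) ^ j * A_coeff M n \<nu> (int j + min M 0)) * (qinf a * qinf (Q / a))"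
  proof (cases "j < nat (- M)")
    case True
    hence "int j + min M 0 < 0" by auto
    thus ?thesis using True by (simp add: fps_X_power_mult_nth A_coeff_neg)
  next
    case False
    hence e: "int j + min M 0 = int (j - nat (- M))" "int j - int (nat M) = int (j - nat (- M)) - M" by auto
    show ?thesis using False A_coeff_generic[OF g a, of M n "j - nat (- M)"]
      unfolding pw e by (simp only: fps_X_power_mult_nth if_False power_int_of_nat mult_ac mult_minus_left mult_minus_right)
  qed
  have "mixed_casorati M n a $ j = (fps_X ^ nat M * mixed_prod n (a * Q powi (M - 1)) (Q / a)) $ j
     + (fps_X ^ nat (- M) * mixed_prod n (1 / (a * Q powi (M - 1))) (a / Q)) $ j * neg_factor a (M - 1) n"
    unfolding mixed_casorati_def fps_add_nth mult.assoc[of "fps_const _"] fps_mult_left_const_nth by (simp only: mult.commute)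
  thus ?thesis using 1 2 by (simp only: distrib_right) (simp add: algebra_simps)
qed

text \<open>
  The coefficient of \<open>(x\<^sup>2 / 4)^j\<close> in \<open>P2 M n \<nu> x q\<close>.
\<close>

definition P_coeff :: "int \<Rightarrow> int \<Rightarrow> complex \<Rightarrow> nat \<Rightarrow> complex" where
  "P_coeff M n \<nu> j = (- qpow q \<nu>) ^ j * (A_coeff M n \<nu> (int j + min M 0) - B_coeff M n \<nu> (int j - max M 0))"

text \<open>
  The factors that would be denominators on the right stand on the left, so that the passage to the
  limit has to deal only with the denominators inside \<open>P_coeff\<close>.
\<close>

lemma coeff_generic:
  assumes R: "reduces_by m n S T" and g: "generic (qpow q \<nu>)" and a: "a = qpow q \<nu>"
  shows "coeff (S a) j * (qpoch a q (m + 1) * (1 - Q / a)) = - ((- 1 / a) ^ nat (m + 1) * P_coeff (m + 1) n \<nu> j)"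
    and "coeff (T a) j * (qpoch (a * Q) q m * (1 - 1 / a)) = (1 / a) * ((- 1 / (a * Q)) ^ nat m * P_coeff m n (\<nu> + 1) j)"
proof -
  have ga: "generic a" using g a by simp
  have anz: "a \<noteq> 0" using a by simp
  have nz: "qinf a \<noteq> 0" "qinf (Q / a) \<noteq> 0" using ga by (auto intro!: generic_qinf generic_mult)
  have a1: "a \<noteq> 1" using ga by (metis generic_def mult.right_neutral power_int_0_right)
  have c: "qinf a * qinf (Q / a) * coeff (S a) j = mixed_casorati (m + 1) n a $ j"
       "qinf a * qinf (Q / a) * coeff (T a) j = mixed_casorati m n (a * Q) $ j"
    using reduction_mixed_casorati[OF R anz, THEN arg_cong[of _ _ "\<lambda>f. f $ j"]] by simp_all
  have "qinf a * qinf (Q / a) * (coeff (S a) j * (qpoch a q (m + 1) * (1 - Q / a))) 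
      = qinf a * qinf (Q / a) * (- ((- 1 / a) ^ nat (m + 1) * P_coeff (m + 1) n \<nu> j))"
    using mixed_casorati_coeff[OF g a, of "m + 1" n j] unfolding c(1)[symmetric] by (simp add: P_coeff_def a mult_ac)
  thus "coeff (S a) j * (qpoch a q (m + 1) * (1 - Q / a)) = - ((- 1 / a) ^ nat (m + 1) * P_coeff (m + 1) n \<nu> j)"
    using nz by (simp only: mult_cancel_left) auto
  have aQ: "a * Q = qpow q (\<nu> + 1)" by (simp add: qpow_add qpow_1 a)
  have "Q / (a * Q) = 1 / a" by simp
  note R2 = mixed_casorati_coeff[OF _ aQ, of m n j, unfolded aQ[symmetric], OF generic_mult(1)[OF ga], unfolded this]
  have q3: "qinf (a * Q) * qinf (1 / a) * (- a) = qinf a * qinf (Q / a)"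
  proof -
    have "qinf (1 / a) * (- a) = (1 - a) * qinf (Q / a)"
      using qinf_step[of "1 / a"] anz by (simp add: field_simps)
    hence "qinf (a * Q) * (qinf (1 / a) * (- a)) = (1 - a) * qinf (a * Q) * qinf (Q / a)" by simp
    thus ?thesis unfolding qinf_step[of a, symmetric] by (simp only: mult.assoc)
  qed
  have "qinf a * qinf (Q / a) * (coeff (T a) j * (qpoch (a * Q) q m * (1 - 1 / a))) * (- a)
      = qinf a * qinf (Q / a) * (- ((- 1 / (a * Q)) ^ nat m * P_coeff m n (\<nu> + 1) j))"
    using arg_cong[OF R2, of "\<lambda>w. w * (- a)"] 
    unfolding c(2)[symmetric] P_coeff_def aQ[symmetric] mult.assoc[of _ "qinf (a * Q) * qinf (1 / a)"] q3 by (simp only: mult_ac)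
  hence "coeff (T a) j * (qpoch (a * Q) q m * (1 - 1 / a)) * (- a) = - ((- 1 / (a * Q)) ^ nat m * P_coeff m n (\<nu> + 1) j)"
    using nz by (simp only: mult.assoc mult_cancel_left) auto
  thus "coeff (T a) j * (qpoch (a * Q) q m * (1 - 1 / a)) = (1 / a) * ((- 1 / (a * Q)) ^ nat m * P_coeff m n (\<nu> + 1) j)"
  proof -
    have "w = (1 / a) * y" if "w * (- a) = - y" for w y :: complex
      using that anz by (simp add: field_simps)
    from this[OF \<open>_ * (- a) = - _\<close>] show ?thesis .
  qed
qed

section \<open>Passage to exceptional orders\<close>

lemma qpoch_tendsto:
  assumes f: "(f \<longlongrightarrow> c) G" and c: "0 \<le> l \<or> qpoch c q l \<noteq> 0"
  shows "((\<lambda>t. qpoch (f t) q l) \<longlongrightarrow> qpoch c q l) G"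
proof (cases "0 \<le> l")
  case True
  thus ?thesis unfolding qpoch_def by (auto intro!: tendsto_intros f)
next
  case False
  hence "(\<Prod>i<nat (- l). 1 - c * Q powi l * Q ^ i) \<noteq> 0"
    using c by (auto simp: qpoch_def)
  thus ?thesis using False unfolding qpoch_def by (auto intro!: tendsto_intros f simp del: prod_zero_iff)
qed

lemma hypergeom_tendsto:
  assumes "(B \<longlongrightarrow> b) G" "(D \<longlongrightarrow> d) G" "\<And>k. qpoch d q (int k) \<noteq> 0"
  shows "((\<lambda>t. basic_hypergeom [Q powi (- int i), B t] [D t] q x) \<longlongrightarrow> basic_hypergeom [Q powi (- int i), b] [d] q x) G"
  unfolding hypergeom_terminating
  by (intro tendsto_intros qpoch_tendsto assms) auto

lemma A_coeff_tendsto: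
  assumes f: "(f \<longlongrightarrow> \<nu>) G"
    and a: "\<And>k. qpoch (qpow q \<nu>) q (int k) \<noteq> 0" "qpoch (qpow q \<nu>) q M \<noteq> 0"
      "j \<ge> 0 \<Longrightarrow> qpoch (qpow q (2 - \<nu>)) q (j - M) \<noteq> 0"
  shows "((\<lambda>t. A_coeff M n (f t) j) \<longlongrightarrow> A_coeff M n \<nu> j) G"
proof (cases "j < 0")
  case False
  define i where "i = nat j"
  have j: "j = int i" using False by (simp add: i_def)
  show ?thesis unfolding A_coeff_def A2_def A2'_def j qpow_of_int[of "- int i"] 
    using a(3) False unfolding j
    by (cases "n \<ge> 0") (auto intro!: tendsto_intros qpoch_tendsto qpow_tendsto hypergeom_tendsto f simp: a qpoch_Q_nz)
qed (simp add: A_coeff_neg)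

lemma B_coeff_tendsto:
  assumes f: "(f \<longlongrightarrow> \<nu>) G"
    and a: "\<And>k. qpoch (qpow q (\<nu> + of_int M)) q (int k) \<noteq> 0"
      "j \<ge> 0 \<Longrightarrow> qpoch (qpow q (2 - \<nu>)) q j \<noteq> 0"
  shows "((\<lambda>t. B_coeff M n (f t) j) \<longlongrightarrow> B_coeff M n \<nu> j) G"
proof (cases "j < 0")
  case False
  define i where "i = nat j"
  have j: "j = int i" using False by (simp add: i_def)
  show ?thesis unfolding B_coeff_def B2_def B2'_def j qpow_of_int[of "- int i"] 
    using a(2) False unfolding j
    by (cases "n \<ge> 0") (auto intro!: tendsto_intros qpoch_tendsto qpow_tendsto hypergeom_tendsto f simp: a qpoch_Q_nz)
qed (simp add: B_coeff_neg)

text \<open>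
  Checking the signs of \<open>m\<close> and \<open>n\<close> shows that the upper limit of summation in
  \<open>P2\<close> is governed by \<open>\<bar>m\<bar> + \<bar>n\<bar>\<close>, the quantity that the walk controls.
\<close>

lemma bound_iff: "int k \<le> P2_bound m n \<longleftrightarrow> 2 * int k \<le> \<bar>m\<bar> + \<bar>n\<bar> - 1"
proof -
  have "\<lfloor>real_of_int (m + n + 1) / 2\<rfloor> = (m + n + 1) div 2"
    using floor_divide_of_int_eq[of "m + n + 1" 2, where ?'a = real] by simp
  moreover have "Min {m, n, m + n, 0} = (if n \<ge> 0 then min m 0 else min n (m + n))"
    by (auto simp: min_def)
  ultimately show ?thesis unfolding P2_bound_def by (auto simp: min_def)
qed

lemma P2_defined_qpoch:
  assumes "P2_defined M n \<nu> q"
  shows "qpoch (qpow q \<nu>) q (int k) \<noteq> 0" "qpoch (qpow q (\<nu> + of_int M)) q (int k) \<noteq> 0"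
    "qpoch (qpow q \<nu>) q M \<noteq> 0"
proof -
  have 1: "qpow q \<nu> * Q ^ k \<noteq> 1" "qpow q \<nu> * Q powi M * Q ^ k \<noteq> 1" for k
    using assms by (simp_all add: P2_defined_def qpow_add qpow_of_nat qpow_of_int)
  show 2: "qpoch (qpow q \<nu>) q (int k) \<noteq> 0" "qpoch (qpow q (\<nu> + of_int M)) q (int k) \<noteq> 0" for k
    using 1 by (auto simp: qpoch_nat qpow_add qpow_of_int)
  show "qpoch (qpow q \<nu>) q M \<noteq> 0"
    using 1 2(1)[of "nat M"] by (cases "M \<ge> 0") (auto simp: qpoch_def)
qed

lemma P_coeff_tendsto:
  assumes f: "(f \<longlongrightarrow> \<nu>) G" and d: "P2_defined M n \<nu> q" and j: "int j \<le> P2_bound M n"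
  shows "((\<lambda>t. P_coeff M n (f t) j) \<longlongrightarrow> P_coeff M n \<nu> j) G"
proof -
  have D: "qpoch (qpow q (2 - \<nu>)) q (int j - max M 0) \<noteq> 0"
    using d j by (auto simp: P2_defined_def)
  have e: "int j + min M 0 - M = int j - max M 0" by auto
  note q = P2_defined_qpoch[OF d]
  show ?thesis unfolding P_coeff_def
    by (intro tendsto_intros qpow_tendsto A_coeff_tendsto B_coeff_tendsto f q) (simp_all only: e D not_False_eq_True)
qed

text \<open>
  If \<open>q\<^sup>\<nu>\<close> is an integral power of \<open>q\<close>, then for \<open>0 < t < 1\<close> the modulus of
  \<open>q\<^sup>\<nu>\<^sup>+\<^sup>t\<close> lies strictly between two consecutive ones, so every exceptional order is a limit
  of generic ones.
\<close>

lemma generic_limit: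
  assumes eq: "\<And>\<nu>. generic (qpow q \<nu>) \<Longrightarrow> f \<nu> = (g \<nu> :: complex)"
    and f: "\<And>h G. (h \<longlongrightarrow> \<nu>) G \<Longrightarrow> ((\<lambda>t. f (h t)) \<longlongrightarrow> f \<nu>) (G :: real filter)"
    and g: "\<And>h G. (h \<longlongrightarrow> \<nu>) G \<Longrightarrow> ((\<lambda>t. g (h t)) \<longlongrightarrow> g \<nu>) (G :: real filter)"
  shows "f \<nu> = g \<nu>"
proof (cases "generic (qpow q \<nu>)")
  case False
  then obtain k where k: "qpow q \<nu> * Q powi k = 1" by (auto simp: generic_def)
  have lim: "((\<lambda>t. \<nu> + of_real t) \<longlongrightarrow> \<nu>) (at_right 0)"
    by (auto intro!: tendsto_eq_intros)
  have "eventually (\<lambda>t. t < (1::real)) (at_right 0)"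
    by (rule eventually_at_rightI[of 0 1]) auto
  moreover have "eventually (\<lambda>t. t > (0::real)) (at_right 0)" by (rule eventually_at_right_less)
  ultimately have "eventually (\<lambda>t. generic (qpow q (\<nu> + of_real t))) (at_right 0)"
  proof eventually_elim
    case (elim t)
    have "qpow q (\<nu> + of_real t) * Q powi l \<noteq> 1" for l
    proof
      assume l: "qpow q (\<nu> + of_real t) * Q powi l = 1"
      have "qpow q (\<nu> + of_real t) * Q powi l = (qpow q \<nu> * Q powi k) * qpow q (of_real t + of_int (l - k))"
        by (simp only: qpow_add qpow_of_int power_int_diff[OF disjI1[OF Q_nz]]) simp
      hence "qpow q (of_real (t + of_int (l - k))) = 1" using l k by simp
      hence "exp ((t + of_int (l - k)) * ln q) = 1"
        unfolding qpow_exp by (metis exp_of_real of_real_1 of_real_eq_iff of_real_mult)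
      hence "t = of_int (k - l)" using q_pos q_less_1 by simp
      with elim show False by (metis of_int_0_less_iff of_int_less_1_iff zless_imp_add1_zle add_0 not_less)
    qed
    thus ?case by (simp add: generic_def)
  qed
  hence "eventually (\<lambda>t. f (\<nu> + of_real t) = g (\<nu> + of_real t)) (at_right 0)"
    by eventually_elim (rule eq)
  with f[OF lim] have "((\<lambda>t. g (\<nu> + of_real t)) \<longlongrightarrow> f \<nu>) (at_right 0)"
    by (rule Lim_transform_eventually)
  from tendsto_unique[OF _ this g[OF lim]] show ?thesis by simp
qed (use eq in blast)

lemma bounded_family_tendsto:
  assumes "bounded_family d S" "(h \<longlongrightarrow> \<nu>) G"
  shows "((\<lambda>t. coeff (S (qpow q (h t))) j) \<longlongrightarrow> coeff (S (qpow q \<nu>)) j) G"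
proof (rule continuous_on_tendsto_compose[where s = "- {0}" and f = "\<lambda>a. coeff (S a) j"])
  show "continuous_on (- {0}) (\<lambda>a. coeff (S a) j)" using assms by (simp add: bounded_family_def)
qed (use assms in \<open>auto intro: qpow_tendsto\<close>)

lemma coeff_S:
  assumes R: "reduces_by m n S T" and d: "P2_defined (m + 1) n \<nu> q" and j: "int j \<le> P2_bound (m + 1) n"
    and a: "a = qpow q \<nu>"
  shows "coeff (S a) j * (qpoch a q (m + 1) * (1 - Q / a)) = - ((- 1 / a) ^ nat (m + 1) * P_coeff (m + 1) n \<nu> j)"
  unfolding a
proof (rule generic_limit[where \<nu> = \<nu> and f = "\<lambda>\<nu>. coeff (S (qpow q \<nu>)) j * (qpoch (qpow q \<nu>) q (m + 1) * (1 - Q / qpow q \<nu>))"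
      and g = "\<lambda>\<nu>. - ((- 1 / qpow q \<nu>) ^ nat (m + 1) * P_coeff (m + 1) n \<nu> j)"])
  fix h and G :: "real filter" assume h: "(h \<longlongrightarrow> \<nu>) G"
  show "((\<lambda>t. coeff (S (qpow q (h t))) j * (qpoch (qpow q (h t)) q (m + 1) * (1 - Q / qpow q (h t)))) \<longlongrightarrow>
      coeff (S (qpow q \<nu>)) j * (qpoch (qpow q \<nu>) q (m + 1) * (1 - Q / qpow q \<nu>))) G"
    using R d by (intro tendsto_intros qpow_tendsto h qpoch_tendsto bounded_family_tendsto[of "\<bar>m + 1\<bar> + \<bar>n\<bar> - 1"]) 
      (auto simp: P2_defined_qpoch reduces_by_def)
  show "((\<lambda>t. - ((- 1 / qpow q (h t)) ^ nat (m + 1) * P_coeff (m + 1) n (h t) j)) \<longlongrightarrow>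
      - ((- 1 / qpow q \<nu>) ^ nat (m + 1) * P_coeff (m + 1) n \<nu> j)) G"
    using j d by (intro tendsto_intros qpow_tendsto h P_coeff_tendsto) auto
qed (rule coeff_generic(1)[OF R _ refl])

lemma coeff_T:
  assumes R: "reduces_by m n S T" and d: "P2_defined m n (\<nu> + 1) q" and j: "int j \<le> P2_bound m n"
    and a: "a = qpow q \<nu>"
  shows "coeff (T a) j * (qpoch (a * Q) q m * (1 - 1 / a)) = (1 / a) * ((- 1 / (a * Q)) ^ nat m * P_coeff m n (\<nu> + 1) j)"
  unfolding a
proof (rule generic_limit[where \<nu> = \<nu> and f = "\<lambda>\<nu>. coeff (T (qpow q \<nu>)) j * (qpoch (qpow q \<nu> * Q) q m * (1 - 1 / qpow q \<nu>))"
      and g = "\<lambda>\<nu>. (1 / qpow q \<nu>) * ((- 1 / (qpow q \<nu> * Q)) ^ nat m * P_coeff m n (\<nu> + 1) j)"])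
  fix h and G :: "real filter" assume h: "(h \<longlongrightarrow> \<nu>) G"
  have q: "qpoch (qpow q \<nu> * Q) q m \<noteq> 0" using P2_defined_qpoch(3)[OF d] by (simp add: qpow_add qpow_1)
  have h1: "((\<lambda>t. h t + 1) \<longlongrightarrow> \<nu> + 1) G" by (intro tendsto_intros h)
  show "((\<lambda>t. coeff (T (qpow q (h t))) j * (qpoch (qpow q (h t) * Q) q m * (1 - 1 / qpow q (h t)))) \<longlongrightarrow>
      coeff (T (qpow q \<nu>)) j * (qpoch (qpow q \<nu> * Q) q m * (1 - 1 / qpow q \<nu>))) G"
    using R q by (intro tendsto_intros qpow_tendsto h qpoch_tendsto bounded_family_tendsto[of "\<bar>m\<bar> + \<bar>n\<bar> - 1"]) 
      (auto simp: reduces_by_def)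
  show "((\<lambda>t. (1 / qpow q (h t)) * ((- 1 / (qpow q (h t) * Q)) ^ nat m * P_coeff m n (h t + 1) j)) \<longlongrightarrow>
      (1 / qpow q \<nu>) * ((- 1 / (qpow q \<nu> * Q)) ^ nat m * P_coeff m n (\<nu> + 1) j)) G"
    using j d by (intro tendsto_intros qpow_tendsto h h1 P_coeff_tendsto) auto
qed (rule coeff_generic(2)[OF R _ refl])

section \<open>Evaluation at a point\<close>

lemma poly_eq_sum_int:
  fixes p :: "complex poly"
  assumes "\<And>k. coeff p k \<noteq> 0 \<Longrightarrow> int k \<le> b"
  shows "poly p z = (\<Sum>j = 0..b. coeff p (nat j) * z ^ nat j)"
proof -
  have "poly p z = (\<Sum>k\<le>degree p. coeff p k * z ^ k)" by (rule poly_altdef)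
  also have "\<dots> = (\<Sum>k\<in>{k. coeff p k \<noteq> 0}. coeff p k * z ^ k)"
    by (rule sum.mono_neutral_right) (auto intro: le_degree)
  also have "\<dots> = (\<Sum>k\<in>nat ` {0..b}. coeff p k * z ^ k)"
  proof (rule sum.mono_neutral_left)
    show "{k. coeff p k \<noteq> 0} \<subseteq> nat ` {0..b}"
      using assms by (auto intro!: image_eqI[of _ _ "int _"])
  qed auto
  also have "\<dots> = (\<Sum>j = 0..b. coeff p (nat j) * z ^ nat j)"
    by (subst sum.reindex) (auto intro!: inj_onI)
  finally show ?thesis .
qed

lemma P2_eq: "P2 M n \<nu> x q = (\<Sum>j = 0..P2_bound M n. P_coeff M n \<nu> (nat j) * ((x / 2)\<^sup>2) ^ nat j)"
proof -
  have 1: "(x / 2) powi (2 * j) * (- 1) powi j * qpow q (of_int j * \<nu>) = (- qpow q \<nu>) ^ nat j * ((x / 2)\<^sup>2) ^ nat j"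
    if j: "j \<ge> 0" for j
  proof -
    obtain k where k: "j = int k" using j by (metis nonneg_int_cases)
    have "(x / 2) powi (2 * int k) = ((x / 2)\<^sup>2) ^ k"
      by (metis of_nat_mult of_nat_numeral power_int_of_nat power_mult)
    thus ?thesis unfolding k qpow_of_int_mult power_int_of_nat by (simp add: power_minus[of "qpow q \<nu>"])
  qed
  have "P2 M n \<nu> x q = (\<Sum>j = 0..P2_bound M n. (x / 2) powi (2 * j) * (- 1) powi j * qpow q (of_int j * \<nu>) *
     (A_coeff M n \<nu> (j + min M 0) - B_coeff M n \<nu> (j - max M 0)))"
    by (simp add: P2_def A_coeff_def B_coeff_def)
  also have "\<dots> = (\<Sum>j = 0..P2_bound M n. P_coeff M n \<nu> (nat j) * ((x / 2)\<^sup>2) ^ nat j)"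
  proof (rule sum.cong[OF refl])
    fix j assume "j \<in> {0..P2_bound M n}"
    hence j: "j \<ge> 0" "int (nat j) = j" by auto
    show "(x / 2) powi (2 * j) * (- 1) powi j * qpow q (of_int j * \<nu>) *
        (A_coeff M n \<nu> (j + min M 0) - B_coeff M n \<nu> (j - max M 0)) = P_coeff M n \<nu> (nat j) * ((x / 2)\<^sup>2) ^ nat j"
      unfolding 1[OF j(1)] P_coeff_def j(2) by (simp only: mult_ac)
  qed
  finally show ?thesis .
qed

lemma poly_S:
  assumes R: "reduces_by m n S T" and d: "P2_defined (m + 1) n \<nu> q" and a: "a = qpow q \<nu>"
  shows "poly (S a) ((x / 2)\<^sup>2) * (qpoch a q (m + 1) * (1 - Q / a)) = - ((- 1 / a) ^ nat (m + 1) * P2 (m + 1) n \<nu> x q)"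
proof -
  have b: "int k \<le> P2_bound (m + 1) n" if "coeff (S a) k \<noteq> 0" for k
    using R that unfolding bound_iff by (auto simp: reduces_by_def bounded_family_def)
  have e: "poly (S a) ((x / 2)\<^sup>2) = (\<Sum>j = 0..P2_bound (m + 1) n. coeff (S a) (nat j) * ((x / 2)\<^sup>2) ^ nat j)"
    by (rule poly_eq_sum_int) (rule b)
  show ?thesis unfolding e P2_eq sum_distrib_left sum_distrib_right sum_negf[symmetric]
  proof (rule sum.cong[OF refl])
    fix j assume "j \<in> {0..P2_bound (m + 1) n}"
    hence j: "int (nat j) \<le> P2_bound (m + 1) n" by simp
    show "coeff (S a) (nat j) * ((x / 2)\<^sup>2) ^ nat j * (qpoch a q (m + 1) * (1 - Q / a)) 
      = - ((- 1 / a) ^ nat (m + 1) * (P_coeff (m + 1) n \<nu> (nat j) * ((x / 2)\<^sup>2) ^ nat j))"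
      using arg_cong[OF coeff_S[OF R d j a], of "\<lambda>w. w * ((x / 2)\<^sup>2) ^ nat j"] by (simp only: mult_ac mult_minus_left mult_minus_right)
  qed
qed

lemma poly_T:
  assumes R: "reduces_by m n S T" and d: "P2_defined m n (\<nu> + 1) q" and a: "a = qpow q \<nu>"
  shows "poly (T a) ((x / 2)\<^sup>2) * (qpoch (a * Q) q m * (1 - 1 / a)) = (1 / a) * ((- 1 / (a * Q)) ^ nat m * P2 m n (\<nu> + 1) x q)"
proof -
  have b: "int k \<le> P2_bound m n" if "coeff (T a) k \<noteq> 0" for k
    using R that unfolding bound_iff by (auto simp: reduces_by_def bounded_family_def)
  have e: "poly (T a) ((x / 2)\<^sup>2) = (\<Sum>j = 0..P2_bound m n. coeff (T a) (nat j) * ((x / 2)\<^sup>2) ^ nat j)"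
    by (rule poly_eq_sum_int) (rule b)
  show ?thesis unfolding e P2_eq sum_distrib_left sum_distrib_right
  proof (rule sum.cong[OF refl])
    fix j assume "j \<in> {0..P2_bound m n}"
    hence j: "int (nat j) \<le> P2_bound m n" by simp
    show "coeff (T a) (nat j) * ((x / 2)\<^sup>2) ^ nat j * (qpoch (a * Q) q m * (1 - 1 / a)) 
      = (1 / a) * ((- 1 / (a * Q)) ^ nat m * (P_coeff m n (\<nu> + 1) (nat j) * ((x / 2)\<^sup>2) ^ nat j))"
      using arg_cong[OF coeff_T[OF R d j a], of "\<lambda>w. w * ((x / 2)\<^sup>2) ^ nat j"] by (simp only: mult_ac)
  qed
qed

text \<open>
  The factors \<open>q^(k\<^sup>2)\<close> make the ratio of consecutive terms tend to zero, so the series converges for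
  every \<open>z\<close>.
\<close>

lemma bessel2_sums:
  assumes b: "\<And>k. b * Q ^ Suc k \<noteq> 1"
  shows "summable (\<lambda>k. bessel2 b $ k * z ^ k)"
    and "qinf (b * Q) * basic_hypergeom [] [b * Q] q (- (z * (b * Q))) = eval_fps (bessel2 b) z"
proof -
  have nz: "qpoch (b * Q) q (int k) \<noteq> 0" for k
    using b by (auto simp: qpoch_nat mult_ac)
  have qnz: "qinf (b * Q) \<noteq> 0" using b by (intro qinf_nz) (simp add: mult_ac)
  have co: "bessel2 b $ k * z ^ k = qinf (b * Q) * (inv_fact k / qpoch (b * Q) q (int k) * Q ^ (k\<^sup>2) * (- (b * z)) ^ k)" for k
    unfolding bessel2_def fps_nth_Abs_fps qinf_div[OF qnz]
    by (simp add: power_mult_distrib power_minus[of "b * z"] mult_ac)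
  define c where "c = (\<lambda>k. bessel2 b $ k * z ^ k)"
  define r where "r = (\<lambda>k. - (b * z) * Q * (Q ^ k)\<^sup>2 / ((1 - Q * Q ^ k) * (1 - b * Q * Q ^ k)))"
  have Qk: "(\<lambda>k. Q ^ k) \<longlonglongrightarrow> 0" using q_pos q_less_1 by (intro LIMSEQ_power_zero) simp
  have cr: "c (Suc k) = r k * c k" for k
  proof -
    have "inv_fact (Suc k) = inv_fact k / (1 - Q ^ Suc k)" using inv_fact_Suc[of k] Q_power_Suc_neq_1[of k] by (simp add: field_simps)
    moreover have "qpoch (b * Q) q (int (Suc k)) = qpoch (b * Q) q (int k) * (1 - b * Q * Q ^ k)"
      by (simp only: qpoch_nat prod.lessThan_Suc)
    moreover have "Q ^ ((Suc k)\<^sup>2) = Q ^ (k\<^sup>2) * (Q ^ k)\<^sup>2 * Q"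
      by (simp add: power2_eq_square algebra_simps flip: power_add)
    ultimately show ?thesis unfolding c_def co r_def by (simp only: divide_inverse inverse_mult_distrib power_Suc mult_ac)
  qed
  have "r \<longlonglongrightarrow> - (b * z) * Q * 0\<^sup>2 / ((1 - Q * 0) * (1 - b * Q * 0))"
    unfolding r_def by (intro tendsto_intros Qk) auto
  hence "(\<lambda>k. norm (r k)) \<longlonglongrightarrow> 0" by (simp add: tendsto_norm_zero)
  hence "eventually (\<lambda>k. norm (r k) < 1 / 2) sequentially" by (rule order_tendstoD) simp
  then obtain N where N: "\<And>k. k \<ge> N \<Longrightarrow> norm (r k) < 1 / 2" by (auto simp: eventually_sequentially)
  have "summable c"
  proof (rule summable_ratio_test[of "1 / 2" N])
    fix k assume "k \<ge> N"
    thus "norm (c (Suc k)) \<le> 1 / 2 * norm (c k)"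
      unfolding cr norm_mult using N[of k] by (intro mult_right_mono) auto
  qed simp
  thus "summable (\<lambda>k. bessel2 b $ k * z ^ k)" by (simp add: c_def)
  define d where "d = (\<lambda>k. inv_fact k / qpoch (b * Q) q (int k) * Q ^ (k\<^sup>2) * (- (b * z)) ^ k)"
  have cd: "c = (\<lambda>k. qinf (b * Q) * d k)" by (simp add: c_def d_def co)
  have "summable d" using \<open>summable c\<close> qnz unfolding cd by (simp add: summable_cmult_iff)
  moreover have "basic_hypergeom [] [b * Q] q (- (z * (b * Q))) = suminf d"
    unfolding basic_hypergeom_def d_def
  proof (intro suminf_cong)
    fix k
    have "2 * (k choose 2) + k = k\<^sup>2"
      by (cases k) (simp_all add: choose_two power2_eq_square)
    hence "Q ^ (k\<^sup>2) = (Q ^ (k choose 2))\<^sup>2 * Q ^ k" by (metis power_add power_mult mult.commute)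
    moreover have "((- 1) ^ k * Q ^ (k choose 2)) powi (1 + int (length [b * Q]) - int (length ([] :: complex list)))
        = (Q ^ (k choose 2))\<^sup>2"
      by (simp add: power_mult_distrib flip: power_mult)
    moreover have "- (z * (b * Q)) = - (b * z) * Q" by simp
    hence "(- (z * (b * Q))) ^ k = (- (b * z)) ^ k * Q ^ k" by (simp only: power_mult_distrib)
    ultimately show "(\<Prod>a\<leftarrow>[]. qpoch a q (int k)) / (qpoch Q q (int k) * (\<Prod>b\<leftarrow>[b * Q]. qpoch b q (int k))) *
         ((- 1) ^ k * Q ^ (k choose 2)) powi (1 + int (length [b * Q]) - int (length ([] :: complex list))) *
         (- (z * (b * Q))) ^ k = inv_fact k / qpoch (b * Q) q (int k) * Q ^ (k\<^sup>2) * (- (b * z)) ^ k"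
      by (simp add: inv_fact_def divide_inverse)
  qed
  moreover have "eval_fps (bessel2 b) z = suminf c" by (simp add: eval_fps_def c_def)
  ultimately show "qinf (b * Q) * basic_hypergeom [] [b * Q] q (- (z * (b * Q))) = eval_fps (bessel2 b) z"
    unfolding cd by (simp only: suminf_mult)
qed

lemma bessel2_conv_radius:
  assumes "\<And>k. b * Q ^ Suc k \<noteq> 1"
  shows "fps_conv_radius (dilate t (bessel2 b)) = \<infinity>"
  unfolding fps_conv_radius_def
proof (rule conv_radius_inftyI'')
  fix z show "summable (\<lambda>k. dilate t (bessel2 b) $ k * z ^ k)"
    using bessel2_sums(1)[OF assms, where z = "t * z"] by (simp add: power_mult_distrib mult_ac)
qed

lemma eval_dilate: "eval_fps (dilate t f) z = eval_fps f (t * z)"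
  by (simp add: eval_fps_def power_mult_distrib mult_ac)

lemma reduction_eval:
  assumes R: "reduces_by m n S T" and a: "a \<noteq> 0"
    and reg: "\<And>k. a * Q ^ Suc k \<noteq> 1" "\<And>k. a / Q * Q ^ Suc k \<noteq> 1" "\<And>k. a * Q powi m * Q ^ Suc k \<noteq> 1"
  shows "z ^ nat m * poly (Epoly n) z * eval_fps (bessel2 (a * Q powi m)) (Q powi n * z)
    = z ^ neg_ind m * poly (S a) z * eval_fps (bessel2 a) z + poly (T a) z * eval_fps (bessel2 (a / Q)) z"
proof -
  have h: "sol_pos a 0 0 = to_fls (bessel2 a)" "zvar * sol_pos a (- 1) 0 = to_fls (bessel2 (a / Q))"
    by (simp_all add: sol_pos_def power_int_minus divide_inverse)
  have "zvar ^ nat (- m) * emb (Epoly n) * sol_pos a m n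
        = zvar ^ neg_ind m * emb (S a) * sol_pos a 0 0 + zvar * emb (T a) * sol_pos a (- 1) 0"
    using R a contiguous_sol_pos unfolding reduces_by_def by blast
  hence "(zvar ^ nat (- m) * zvar powi m) * emb (Epoly n) * to_fls (dilate (Q powi n) (bessel2 (a * Q powi m)))
        = zvar ^ neg_ind m * emb (S a) * to_fls (bessel2 a) + emb (T a) * (zvar * sol_pos a (- 1) 0)"
    by (simp only: h(1)) (simp add: sol_pos_def mult_ac)
  hence "to_fls (fps_X ^ nat m * fps_of_poly (Epoly n) * dilate (Q powi n) (bessel2 (a * Q powi m)))
       = to_fls (fps_X ^ neg_ind m * fps_of_poly (S a) * bessel2 a + fps_of_poly (T a) * bessel2 (a / Q))"
    unfolding zvar_clear h(2) by (simp add: to_fls_mult fps_to_fls_power zvar_eq emb_def)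
  hence e: "fps_X ^ nat m * fps_of_poly (Epoly n) * dilate (Q powi n) (bessel2 (a * Q powi m))
       = fps_X ^ neg_ind m * fps_of_poly (S a) * bessel2 a + fps_of_poly (T a) * bessel2 (a / Q)"
    by (simp only: fps_to_fls_eq_iff)
  have X: "fps_X ^ k = fps_of_poly (monom (1::complex) k)" for k by (simp add: fps_of_poly_monom')
  have r: "fps_conv_radius (fps_of_poly p * f) = \<infinity>" "eval_fps (fps_of_poly p * f) z = poly p z * eval_fps f z"
    if "fps_conv_radius f = \<infinity>" for p and f :: "complex fps"
    using that fps_conv_radius_mult[of "fps_of_poly p" f] by (auto simp: eval_fps_mult eval_fps_of_poly)
  have c: "fps_conv_radius (dilate t (bessel2 a)) = \<infinity>" "fps_conv_radius (dilate t (bessel2 (a / Q))) = \<infinity>" 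
      "fps_conv_radius (dilate t (bessel2 (a * Q powi m))) = \<infinity>" for t
    by (rule bessel2_conv_radius; use reg in blast)+
  note c' = c(1)[of 1, simplified] c(2)[of 1, simplified]
  have "eval_fps (fps_of_poly (monom 1 (nat m) * Epoly n) * dilate (Q powi n) (bessel2 (a * Q powi m))) z
     = eval_fps (fps_of_poly (monom 1 (neg_ind m) * S a) * bessel2 a + fps_of_poly (T a) * bessel2 (a / Q)) z"
    using e unfolding X by (simp only: fps_of_poly_mult)
  also have "\<dots> = eval_fps (fps_of_poly (monom 1 (neg_ind m) * S a) * bessel2 a) z + eval_fps (fps_of_poly (T a) * bessel2 (a / Q)) z"
    by (rule eval_fps_add) (use r(1) c' in simp_all)
  finally show ?thesis unfolding r(2)[OF c(3)] r(2)[OF c'(1)] r(2)[OF c'(2)] eval_dilate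
    by (simp add: poly_monom)
qed

text \<open>
  The argument of \<open>x q\<^sup>n\<^sup>/\<^sup>2\<close> equals that of \<open>x\<close>, so the principal branch of the power is
  multiplicative here.
\<close>

lemma powr_of_real_mult:
  assumes "r > 0" "y \<noteq> 0"
  shows "(y * of_real r) powr s = y powr s * (of_real r :: complex) powr s"
proof -
  have "Ln (y * of_real r) = Ln y + of_real (ln r)"
    using Ln_times_of_real[of r y] assms by (simp add: mult.commute add.commute Ln_of_real)
  thus ?thesis using assms by (simp add: powr_def Ln_of_real exp_add algebra_simps)
qed

lemma jackson_eval:
  assumes x: "x \<noteq> 0" and reg: "\<And>k. qpow q s * Q ^ Suc k \<noteq> 1"
  shows "jackson_bessel2 s x q = (x / 2) powr s * eval_fps (bessel2 (qpow q s)) ((x / 2)\<^sup>2) / qinf Q"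
proof -
  have 1: "qpow q (s + 1) = qpow q s * Q" by (simp add: qpow_add qpow_1)
  have 2: "- (x\<^sup>2 * (qpow q s * Q) / 4) = - ((x / 2)\<^sup>2 * (qpow q s * Q))" by (simp add: power_divide)
  show ?thesis unfolding jackson_bessel2_def 1 2 bessel2_sums(2)[OF reg, symmetric]
    using x by (simp add: cpow_def qinf_def)
qed

lemma jackson_scaled_eval:
  assumes x: "x \<noteq> 0" and reg: "\<And>k. qpow q s * Q ^ Suc k \<noteq> 1"
  shows "jackson_bessel2 s (x * qpow q (of_int n / 2)) q
    = qpow q (s * of_int n / 2) * (x / 2) powr s * eval_fps (bessel2 (qpow q s)) (Q powi n * (x / 2)\<^sup>2) / qinf Q"
proof -
  define r where "r = exp (of_int n / 2 * ln q)"
  have r: "qpow q (of_int n / 2) = of_real r" by (simp add: qpow_exp r_def flip: exp_of_real)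
  have r2: "(of_real r)\<^sup>2 = Q powi n"
    unfolding r[symmetric] power2_eq_square qpow_add[symmetric] by (simp add: qpow_of_int)
  have rs: "(of_real r :: complex) powr s = qpow q (s * of_int n / 2)"
    by (simp add: powr_def Ln_of_real qpow_exp r_def mult.assoc)
  have "x * of_real r \<noteq> 0" using x by (simp add: r_def)
  from jackson_eval[OF this reg] have "jackson_bessel2 s (x * of_real r) q
    = (x * of_real r / 2) powr s * eval_fps (bessel2 (qpow q s)) ((x * of_real r / 2)\<^sup>2) / qinf Q" .
  moreover have "(x * of_real r / 2) powr s = (x / 2) powr s * qpow q (s * of_int n / 2)"
    using powr_of_real_mult[of r "x / 2" s] x rs by (simp add: r_def)
  moreover have "(x * of_real r / 2)\<^sup>2 = Q powi n * (x / 2)\<^sup>2"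
    by (simp add: power_mult_distrib power_divide r2)
  ultimately show ?thesis unfolding r by (simp add: mult_ac)
qed

lemma poly_Epoly: "poly (Epoly n) z = qpoch (- z) q (max n 0)"
  unfolding Epoly_def by (simp add: poly_prod qpoch_def max_def mult.commute)

text \<open>
  What is left is to compare the constants in \<open>R2\<close> with those produced by the reduction.  The factor
  \<open>(q\<^sup>\<nu>\<^sup>+\<^sup>m\<^sup>+\<^sup>1; q)\<^sub>\<infinity>\<close> of \<open>R2\<close> arises from the factorials \<open>(q\<^sup>\<nu>; q)\<^sub>m\<^sub>+\<^sub>1\<close>
  and \<open>(q\<^sup>\<nu>\<^sup>+\<^sup>1; q)\<^sub>m\<close> in the denominators of \<open>S\<close> and \<open>T\<close>.
\<close>

lemma jackson_reduction:
  fixes \<nu> x :: complex and m n :: int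
  assumes h1: "\<forall>k::nat. qpow q (\<nu> - 1 + of_nat k) \<noteq> 1"
    and h2: "\<forall>k::nat. qpow q (\<nu> + of_int m + 1 + of_nat k) \<noteq> 1"
    and d1: "P2_defined (m + 1) n \<nu> q" and d2: "P2_defined m n (\<nu> + 1) q"
    and E: "qpoch (- (x\<^sup>2 / 4)) q (max n 0) \<noteq> 0"
    and x: "x \<noteq> 0"
  shows "qpow q (- ((\<nu> + of_int m) * of_int n / 2) + of_int m * \<nu> + of_int (m * (m - 1)) / 2) *
           jackson_bessel2 (\<nu> + of_int m) (x * qpow q (of_int n / 2)) q
         = R2 m n \<nu> x q * jackson_bessel2 \<nu> x q
           - R2 (m - 1) n (\<nu> + 1) x q * jackson_bessel2 (\<nu> - 1) x q"
proof -
  obtain S T where R: "reduces_by m n S T" using reducible_all[of m n] by (auto simp: reducible_def)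
  define a where "a = qpow q \<nu>"
  define y where "y = x / 2"
  define Ez where "Ez = qpoch (- (x\<^sup>2 / 4)) q (max n 0)"
  define pM pm where "pM = qpoch a q (m + 1)" and "pm = qpoch (a * Q) q m"
  define cm where "cm = qpow q (of_int (m * (m - 1)) / 2)"
  define P P' where "P = P2 (m + 1) n \<nu> x q" and "P' = P2 m n (\<nu> + 1) x q"
  define e0 e1 em where "e0 = eval_fps (bessel2 a) (y\<^sup>2)" and "e1 = eval_fps (bessel2 (a / Q)) (y\<^sup>2)"
    and "em = eval_fps (bessel2 (a * Q powi m)) (Q powi n * y\<^sup>2)"
  have y: "y \<noteq> 0" using x by (simp add: y_def)
  have a: "a \<noteq> 0" by (simp add: a_def)
  have r1: "a / Q * Q ^ k \<noteq> 1" for k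
    using h1 by (simp add: qpow_add qpow_diff qpow_of_nat qpow_1 a_def)
  have r2: "a * Q powi m * Q ^ Suc k \<noteq> 1" for k
    using h2 by (simp add: qpow_add qpow_of_int qpow_of_nat qpow_1 a_def mult_ac)
  have r0: "a * Q ^ k \<noteq> 1" for k using r1[of "Suc k"] by simp
  have nz: "qinf a \<noteq> 0" "qinf (a / Q) \<noteq> 0" "qinf (a * Q) \<noteq> 0"
    using r0 r1 by (auto intro!: qinf_nz simp: mult.assoc simp flip: power_Suc)
  have nz1: "1 - a \<noteq> 0" "1 - a / Q \<noteq> 0" "a \<noteq> Q" using r0[of 0] r1[of 0] by auto
  have sa: "qinf (a / Q) = (1 - a / Q) * qinf a" "qinf a = (1 - a) * qinf (a * Q)"
    using qinf_step[of "a / Q"] qinf_step[of a] by simp_all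
  have pM: "pM \<noteq> 0" unfolding pM_def a_def by (rule P2_defined_qpoch(3)[OF d1])
  have pm: "pm \<noteq> 0" unfolding pm_def a_def using P2_defined_qpoch(3)[OF d2] by (simp add: qpow_add qpow_1)
  have qM: "pM * qinf (a * Q powi (m + 1)) = qinf a" unfolding pM_def
    using pM by (intro qpoch_mult_qinf) (auto simp: pM_def qpoch_def)
  have qm: "pm * qinf (a * Q powi (m + 1)) = qinf (a * Q)"
  proof -
    have "pm * qinf (a * Q * Q powi m) = qinf (a * Q)" unfolding pm_def
      using pm by (intro qpoch_mult_qinf) (auto simp: pm_def qpoch_def)
    thus ?thesis by (simp add: power_int_add mult_ac)
  qed
  define X where "X = qinf (a * Q powi (m + 1))"
  have Ep: "poly (Epoly n) (y\<^sup>2) = Ez" by (simp add: poly_Epoly Ez_def y_def power_divide)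
  have Ez: "Ez \<noteq> 0" using E by (simp add: Ez_def)
  have main: "(y\<^sup>2) ^ nat m * Ez * em = (y\<^sup>2) ^ neg_ind m * poly (S a) (y\<^sup>2) * e0 + poly (T a) (y\<^sup>2) * e1"
    using reduction_eval[OF R a, of "y\<^sup>2"] r0 r1 r2 unfolding Ep e0_def e1_def em_def by blast
  have S: "poly (S a) (y\<^sup>2) = - ((- 1 / a) ^ nat (m + 1) * P) / (pM * (1 - Q / a))"
    using poly_S[OF R d1 a_def, of x] pM nz1 a
    by (simp add: P_def y_def pM_def field_simps)
  have T: "poly (T a) (y\<^sup>2) = (1 / a) * ((- 1 / (a * Q)) ^ nat m * P') / (pm * (1 - 1 / a))"
    using poly_T[OF R d2 a_def, of x] pm nz1 a
    by (simp add: P'_def y_def pm_def field_simps)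
  have ev0: "jackson_bessel2 \<nu> x q = y powr \<nu> * e0 / qinf Q"
    using jackson_eval[OF x, of \<nu>] r0 by (simp add: a_def y_def e0_def del: power_Suc)
  have ev1: "jackson_bessel2 (\<nu> - 1) x q = y powr \<nu> / y * e1 / qinf Q"
    using jackson_eval[OF x, of "\<nu> - 1"] r1 y
    by (simp add: a_def y_def e1_def qpow_diff qpow_1 powr_diff del: power_Suc)
  have pw: "y powr of_int m = y powi m"
    using y by (simp add: powr_of_int power_int_def power_inverse)
  have evm: "jackson_bessel2 (\<nu> + of_int m) (x * qpow q (of_int n / 2)) q
     = qpow q ((\<nu> + of_int m) * of_int n / 2) * (y powr \<nu> * y powi m) * em / qinf Q"
    using jackson_scaled_eval[OF x, of "\<nu> + of_int m" n] r2 y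
    by (simp add: a_def y_def em_def qpow_add[of \<nu>] qpow_of_int powr_add pw[unfolded y_def] del: power_Suc)
  have L: "qpow q (- ((\<nu> + of_int m) * of_int n / 2) + of_int m * \<nu> + of_int (m * (m - 1)) / 2)
     * qpow q ((\<nu> + of_int m) * of_int n / 2) = a powi m * cm"
    by (simp only: qpow_add[of "- _ + _"] qpow_add[of "- _"] qpow_minus qpow_of_int_mult a_def cm_def) simp
  have R2a: "R2 m n \<nu> x q = X / (qinf (a / Q) * Ez) * (- 1) ^ nat (m + 1) * (a powi min (m + 1) 0 * cm / Q) * y powi min (m + 2) (- m) * P"
  proof -
    have "max (m + 1) 0 = int (nat (m + 1))" by auto
    moreover have "qpow q (of_int (min (m + 1) 0) * \<nu> + of_int (m * (m - 1)) / 2 - 1) = a powi min (m + 1) 0 * cm / Q"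
      by (simp only: qpow_diff qpow_add qpow_of_int_mult qpow_1 a_def cm_def)
    moreover have "qpow q (\<nu> + of_int m + 1) = a * Q powi (m + 1)"
      by (simp add: qpow_add qpow_of_int qpow_1 a_def power_int_add)
    moreover have "qpow q (\<nu> - 1) = a / Q" by (simp add: qpow_diff qpow_1 a_def)
    ultimately show ?thesis unfolding R2_def by (simp only: X_def Ez_def P_def y_def qinf_def power_int_of_nat)
  qed
  have R2b: "R2 (m - 1) n (\<nu> + 1) x q = X / (qinf a * Ez) * (- 1) ^ nat m * ((a * Q) powi min m 0 * (cm * Q powi (- m))) * y powi min (m + 1) (1 - m) * P'"
  proof -
    have "max m 0 = int (nat m)" by auto
    moreover have "of_int ((m - 1) * (m - 1 - 1)) / 2 - 1 = of_int (m * (m - 1)) / 2 + (of_int (- m) :: complex)"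
      by (simp add: field_simps)
    hence "qpow q (of_int (min m 0) * (\<nu> + 1) + of_int ((m - 1) * (m - 1 - 1)) / 2 - 1) = (a * Q) powi min m 0 * (cm * Q powi (- m))"
      by (simp only: add_diff_eq[symmetric] qpow_add qpow_of_int_mult qpow_of_int qpow_1 a_def cm_def)
    moreover have "qpow q (\<nu> + 1 + of_int (m - 1) + 1) = a * Q powi (m + 1)"
      by (simp add: qpow_add qpow_of_int qpow_1 a_def power_int_add)
    moreover have "qpow q (\<nu> + 1 - 1) = a" by (simp add: a_def)
    moreover have "m - 1 + 1 = m" "m - 1 + 2 = m + 1" "- (m - 1) = 1 - m" by auto
    ultimately show ?thesis unfolding R2_def by (simp only: X_def Ez_def P'_def y_def qinf_def power_int_of_nat)
  qed
  have yp: "y powi min (m + 2) (- m) * (y\<^sup>2) ^ nat m = y powi m * (y\<^sup>2) ^ neg_ind m"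
    "y powi min (m + 1) (1 - m) / y * (y\<^sup>2) ^ nat m = y powi m"
  proof -
    have p: "(y\<^sup>2) ^ k = y powi (2 * int k)" for k
      by (metis of_nat_mult of_nat_numeral power_int_of_nat power_mult)
    have "min (m + 2) (- m) + 2 * int (nat m) = m + 2 * int (neg_ind m)"
      by (auto simp: neg_ind_def min_def)
    thus "y powi min (m + 2) (- m) * (y\<^sup>2) ^ nat m = y powi m * (y\<^sup>2) ^ neg_ind m"
      unfolding p power_int_add[OF disjI1[OF y], symmetric] by simp
    have "min (m + 1) (1 - m) - 1 + 2 * int (nat m) = m" by (auto simp: min_def)
    hence "y powi (min (m + 1) (1 - m) - 1) * y powi (2 * int (nat m)) = y powi m"
      unfolding power_int_add[OF disjI1[OF y], symmetric] by simp
    thus "y powi min (m + 1) (1 - m) / y * (y\<^sup>2) ^ nat m = y powi m"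
      unfolding p power_int_diff[OF disjI1[OF y]] by simp
  qed
  have ap: "a powi min (m + 1) 0 = a powi m * a * (1 / a) ^ nat (m + 1)"
  proof -
    have "(1 / a) ^ nat (m + 1) = a powi (- int (nat (m + 1)))"
      by (simp only: power_int_minus power_int_of_nat power_one_over inverse_eq_divide)
    moreover have "min (m + 1) 0 = m + 1 + (- int (nat (m + 1)))" by auto
    ultimately show ?thesis
      by (simp only: power_int_add[OF disjI1[OF a]] power_int_1_right)
  qed
  have aqp: "(a * Q) powi min m 0 * Q powi (- m) = a powi m * (1 / (a * Q)) ^ nat m"
  proof -
    have aq: "a * Q \<noteq> 0" using a by simp
    have "(1 / (a * Q)) ^ nat m = (a * Q) powi (- int (nat m))"
      by (simp only: power_int_minus power_int_of_nat power_one_over inverse_eq_divide)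
    moreover have "min m 0 = m + (- int (nat m))" by auto
    ultimately have "(a * Q) powi min m 0 = (a * Q) powi m * (1 / (a * Q)) ^ nat m"
      by (simp only: power_int_add[OF disjI1[OF aq]])
    thus ?thesis by (simp add: power_int_mult_distrib power_int_minus)
  qed
  have sg: "(- 1 / b) ^ k = (- 1) ^ k * (1 / b) ^ k" for b :: complex and k
    by (simp flip: power_mult_distrib)
  have X0: "X \<noteq> 0" using qM nz(1) by (auto simp: X_def)
  have c1: "X / qinf (a / Q) * (a / Q) = - (1 / (pM * (1 - Q / a)))"
    unfolding sa(1) qM[symmetric] X_def[symmetric] using X0 pM nz1 a by (simp add: field_simps)
  have c2: "X / qinf a = - ((1 / a) / (pm * (1 - 1 / a)))"
    unfolding sa(2) qm[symmetric] X_def[symmetric] using X0 pm nz1 a by (simp add: field_simps)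
  have I1: "R2 m n \<nu> x q * (Ez * (y\<^sup>2) ^ nat m) = a powi m * cm * y powi m * ((y\<^sup>2) ^ neg_ind m * poly (S a) (y\<^sup>2))"
  proof -
    have "R2 m n \<nu> x q * (Ez * (y\<^sup>2) ^ nat m) = (X / qinf (a / Q) * (a / Q)) * (- 1) ^ nat (m + 1) * (1 / a) ^ nat (m + 1)
        * a powi m * cm * (y powi min (m + 2) (- m) * (y\<^sup>2) ^ nat m) * P"
      unfolding R2a ap using Ez by (simp add: mult_ac)
    also have "\<dots> = a powi m * cm * y powi m * ((y\<^sup>2) ^ neg_ind m * poly (S a) (y\<^sup>2))"
      unfolding c1 yp S sg by (simp add: mult_ac)
    finally show ?thesis .
  qed
  have I2: "- (R2 (m - 1) n (\<nu> + 1) x q / y * (Ez * (y\<^sup>2) ^ nat m)) = a powi m * cm * y powi m * poly (T a) (y\<^sup>2)"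
  proof -
    have "- (R2 (m - 1) n (\<nu> + 1) x q / y * (Ez * (y\<^sup>2) ^ nat m)) = - (X / qinf a) * (- 1) ^ nat m * ((a * Q) powi min m 0 * Q powi (- m))
        * cm * (y powi min (m + 1) (1 - m) / y * (y\<^sup>2) ^ nat m) * P'"
      unfolding R2b using Ez by (simp add: mult_ac)
    also have "\<dots> = a powi m * cm * y powi m * poly (T a) (y\<^sup>2)"
      unfolding c2 yp T sg aqp by (simp add: mult_ac)
    finally show ?thesis .
  qed
  have "(a powi m * cm * y powi m * em) * (Ez * (y\<^sup>2) ^ nat m) = a powi m * cm * y powi m * ((y\<^sup>2) ^ nat m * Ez * em)"
    by (simp only: mult_ac)
  also have "\<dots> = (R2 m n \<nu> x q * (Ez * (y\<^sup>2) ^ nat m)) * e0 + (- (R2 (m - 1) n (\<nu> + 1) x q / y * (Ez * (y\<^sup>2) ^ nat m))) * e1"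
    unfolding main I1 I2 by (simp add: algebra_simps)
  also have "\<dots> = (R2 m n \<nu> x q * e0 - R2 (m - 1) n (\<nu> + 1) x q / y * e1) * (Ez * (y\<^sup>2) ^ nat m)"
    by (simp add: algebra_simps)
  finally have fin: "a powi m * cm * y powi m * em = R2 m n \<nu> x q * e0 - R2 (m - 1) n (\<nu> + 1) x q / y * e1"
    using Ez y by (simp only: mult_cancel_right) auto
  have "qpow q (- ((\<nu> + of_int m) * of_int n / 2) + of_int m * \<nu> + of_int (m * (m - 1)) / 2) *
           jackson_bessel2 (\<nu> + of_int m) (x * qpow q (of_int n / 2)) q
      = (a powi m * cm * y powi m * em) * (y powr \<nu> / qinf Q)"
    unfolding evm using arg_cong[OF L, of "\<lambda>w. w * (y powr \<nu> * y powi m * em / qinf Q)"] by (simp add: mult_ac)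
  also have "\<dots> = R2 m n \<nu> x q * jackson_bessel2 \<nu> x q
           - R2 (m - 1) n (\<nu> + 1) x q * jackson_bessel2 (\<nu> - 1) x q"
    unfolding fin ev0 ev1 by (simp add: algebra_simps)
  finally show ?thesis .
qed

lemma P2_polynomial:
  "\<exists>p :: complex poly. (\<forall>y. P2 k l \<mu> y q = poly p (y\<^sup>2)) \<and> (p = 0 \<or> int (degree p) \<le> P2_bound k l)"
proof -
  define p where "p = (\<Sum>j = 0..P2_bound k l. monom (P_coeff k l \<mu> (nat j) * (1 / 4) ^ nat j) (nat j))"
  have "P2 k l \<mu> y q = poly p (y\<^sup>2)" for y
    unfolding P2_eq p_def poly_sum poly_monom
    by (intro sum.cong refl) (simp add: power_divide power_one_over mult_ac)
  moreover have "int (degree p) \<le> P2_bound k l" if "p \<noteq> 0"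
  proof -
    have "P2_bound k l \<ge> 0" using that by (cases "P2_bound k l \<ge> 0") (auto simp: p_def)
    moreover have "degree p \<le> nat (P2_bound k l)"
      unfolding p_def by (rule degree_sum_le) (auto intro: order_trans[OF degree_monom_le])
    ultimately show ?thesis by simp
  qed
  ultimately show ?thesis by blast
qed

lemma jackson_at_0: "Re s > 0 \<Longrightarrow> jackson_bessel2 s 0 q = 0"
  by (auto simp: jackson_bessel2_def cpow_def)

end

theorem theorem5:
  fixes q :: real and \<nu> x :: complex and m n :: int
  assumes "0 < q" and "q < 1"
    \<comment> \<open>nonvanishing of \<open>(q\<^sup>\<nu>\<^sup>-\<^sup>1; q)\<^sub>\<infinity>\<close>; covers the lower parameters \<open>q\<^sup>\<nu>\<close> and \<open>q\<^sup>\<nu>\<^sup>+\<^sup>1\<close>\<close>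
    and "\<forall>k::nat. qpow q (\<nu> - 1 + of_nat k) \<noteq> 1"
    \<comment> \<open>the lower parameter \<open>q\<^sup>\<nu>\<^sup>+\<^sup>m\<^sup>+\<^sup>1\<close> of the left-hand side\<close>
    and "\<forall>k::nat. qpow q (\<nu> + of_int m + 1 + of_nat k) \<noteq> 1"
    and "P2_defined (m + 1) n \<nu> q" and "P2_defined m n (\<nu> + 1) q"
    and "qpoch (- (x\<^sup>2 / 4)) q (max n 0) \<noteq> 0"
    \<comment> \<open>every power of \<open>x / 2\<close> that occurs is defined at \<open>x = 0\<close>\<close>
    and "x = 0 \<longrightarrow> Re \<nu> > 1 \<and> (m = -1 \<or> m = 0)"
  shows "qpow q (- ((\<nu> + of_int m) * of_int n / 2) + of_int m * \<nu> + of_int (m * (m - 1)) / 2) *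
           jackson_bessel2 (\<nu> + of_int m) (x * qpow q (of_int n / 2)) q
         = R2 m n \<nu> x q * jackson_bessel2 \<nu> x q
           - R2 (m - 1) n (\<nu> + 1) x q * jackson_bessel2 (\<nu> - 1) x q
       \<and> (\<forall>k l \<mu>. \<exists>p :: complex poly.
            (\<forall>y. P2 k l \<mu> y q = poly p (y\<^sup>2)) \<and>
            (p = 0 \<or> int (degree p) \<le> P2_bound k l))"
proof -
  interpret q_base q using assms(1,2) by unfold_locales
  show ?thesis
  proof (rule conjI)
    show "qpow q (- ((\<nu> + of_int m) * of_int n / 2) + of_int m * \<nu> + of_int (m * (m - 1)) / 2) *
           jackson_bessel2 (\<nu> + of_int m) (x * qpow q (of_int n / 2)) q
         = R2 m n \<nu> x q * jackson_bessel2 \<nu> x q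
           - R2 (m - 1) n (\<nu> + 1) x q * jackson_bessel2 (\<nu> - 1) x q"
    proof (cases "x = 0")
      case True
      hence "Re \<nu> > 1" "Re (\<nu> + of_int m) > 0" "Re (\<nu> - 1) > 0" "Re \<nu> > 0" using assms(8) by auto
      thus ?thesis using True by (simp add: jackson_at_0)
    qed (use jackson_reduction assms(3-7) in blast)
  qed (use P2_polynomial in blast)
qed

end
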